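(* Let $x,y\in\mathbb{YF}$ with $|y|\ge|x|$, let $z=h(x,y)$ and let $S$ be a non-negative integer. For integers $X\ge 0$ put $m(X,S)=\min\{\lfloor X/2\rfloor,S\}$, and use the convention $(-1)!!=1$. Then the number $d(x,y,S)$ of $S$-paths from $y$ to $x$ in the Young--Fibonacci graph is $$d(x,y,S)=\sum_{i=0}^{|x|}\left(\sum_{k=0}^{m(|x|-i,S)}(-1)^k\binom{|x|-i}{2k}(2k-1)!!\,\binom{|y|-i+2S-2k}{|y|-i}(2S-2k-1)!!\right)F(x,y,i),$$ where $$F(x,y,i)=f(x,i,z)\prod_{j=1}^{d(y)}\bigl(g(y,j)-i\bigr).$$
   Context: $\mathbb{YF}$ is the set of all finite words over the alphabet $\{1,2\}$, including the empty word $\varepsilon$; words are concatenated by juxtaposition. For $x\in\mathbb{YF}$: $|x|$ is the sum of its digits, $\#x$ its number of digits, $d(x)$ its number of digits equal to $2$. Empty products equal $1$. Young--Fibonacci graph: vertex set $\mathbb{YF}$, graded by $|\cdot|$; the upward edges from $x$ go to the words obtained from $x$ by either (a) replacing the leftmost $1$ by $2$ (if $x$ contains a $1$), or (b) inserting a $1$ at a position to the left of the leftmost $1$ (if $x$ has no $1$, at any position, including both ends). So each edge joins a word of digit sum $n$ to one of digit sum $n+1$. Edges may be traversed in both directions. For $|y|\ge |x|$, an $S$-path from $y$ to $x$ is a sequence $y=y_0,y_1,\dots,y_n=x$ of vertices, consecutive ones adjacent, with exactly $S$ indices $i\in\{1,\dots,n\}$ such that $|y_i|-|y_{i-1}|=1$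 (all other steps having $|y_i|-|y_{i-1}|=-1$; hence $n=|y|-|x|+2S$). $d(x,y,S)$ is the number of such paths. $h(x,y)$ is the number of digits of the longest common suffix of $x$ and $y$. $n!!$ for odd $n\ge1$ is the product $1\cdot3\cdots n$. Function $f(x,y,z)$, for $x\in\mathbb{YF}$ and integers $0\le y\le |x|$, $0\le z\le \#x$: For $z=0$: if $x=\alpha_1\dots\alpha_n$ (digits $\alpha_i\in\{1,2\}$) and there is $m\in\{0,\dots,n\}$ with $\alpha_{m+1}+\dots+\alpha_n=y$, then $$f(x,y,0)=\frac{1}{(-\alpha_{m+1})(-\alpha_{m+1}-\alpha_{m+2})\cdots(-\alpha_{m+1}-\dots-\alpha_n)}\cdot\frac{1}{\alpha_m(\alpha_m+\alpha_{m-1})\cdots(\alpha_m+\dots+\alpha_1)};$$ if there is no such $m$, then $f(x,y,0)=0$. For $z>0$, recursively: $f(x1,0,z)=f(x1,0,0)$; $f(x1,y,z)=f(x1,y,0)+f(x,y-1,z-1)$ if $y>0$; $f(x2,y,z)=\dfrac{f(x11,y,z+1)}{1-y}$ if $y\ne1$, and $f(x2,1,z)=0$. Function $g$: write $y=1^{\beta_{d(y)}}\,2\,1^{\beta_{d(y)-1}}\,2\cdots 2\,1^{\beta_1}\,2\,1^{\beta_0}$ with all $\beta_i\ge0$ ($1^{\beta}$ means $\beta$ ones). For $1\le m\le d(y)$, $g(y,m)=\beta_0+\dots+\beta_{m-1}+2m-1$. *)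

theory Defs
  imports Complex_Main "HOL-Library.Sublist"
begin

text \<open>The Young--Fibonacci graph. The head of a list is the leftmost digit of the word.\<close>

datatype digit = One | Two

type_synonym yf_word = "digit list"

primrec digit_val :: "digit \<Rightarrow> nat" where
  "digit_val One = 1"
| "digit_val Two = 2"

definition digit_sum :: "yf_word \<Rightarrow> nat" where
  "digit_sum w = (\<Sum>a\<leftarrow>w. digit_val a)"

definition num_twos :: "yf_word \<Rightarrow> nat" where
  "num_twos w = count_list w Two"

inductive yf_up :: "yf_word \<Rightarrow> yf_word \<Rightarrow> bool" where
  replace: "One \<notin> set p \<Longrightarrow> yf_up (p @ One # w) (p @ Two # w)"
| insert: "One \<notin> set p \<Longrightarrow> yf_up (p @ w) (p @ One # w)"

definition yf_adj :: "yf_word \<Rightarrow> yf_word \<Rightarrow> bool" where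
  "yf_adj u v \<longleftrightarrow> yf_up u v \<or> yf_up v u"

text \<open>A path \<open>y\<^sub>0, \<dots>, y\<^sub>n\<close> is the list \<open>ps\<close> of its \<open>n + 1\<close> vertices.\<close>

definition is_S_path :: "nat \<Rightarrow> yf_word \<Rightarrow> yf_word \<Rightarrow> yf_word list \<Rightarrow> bool" where
  "is_S_path S y x ps \<longleftrightarrow>
     ps \<noteq> [] \<and> hd ps = y \<and> last ps = x \<and>
     (\<forall>i\<in>{1..<length ps}. yf_adj (ps ! (i - 1)) (ps ! i)) \<and>
     card {i \<in> {1..<length ps}.
       int (digit_sum (ps ! i)) - int (digit_sum (ps ! (i - 1))) = 1} = S"

definition num_S_paths :: "yf_word \<Rightarrow> yf_word \<Rightarrow> nat \<Rightarrow> nat" where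
  "num_S_paths x y S = card {ps. is_S_path S y x ps}"

definition common_suffix_length :: "yf_word \<Rightarrow> yf_word \<Rightarrow> nat" where
  "common_suffix_length x y = Max {length s | s. suffix s x \<and> suffix s y}"

text \<open>The product of the odd numbers up to \<open>n\<close>; in particular it is \<open>1\<close> for \<open>n = - 1\<close>.\<close>

definition odd_dfact :: "int \<Rightarrow> int" where
  "odd_dfact n = \<Prod>{j \<in> {1..n}. odd j}"

text \<open>In the next definition \<open>\<alpha> l\<close> is the \<open>l\<close>-th digit counted from 1. The split position \<open>m\<close>
  is unique if it exists, since digits are positive.\<close>

definition yf_f0 :: "yf_word \<Rightarrow> nat \<Rightarrow> rat" where
  "yf_f0 x y =
     (let n = length x;
          \<alpha> = (\<lambda>l. rat_of_nat (digit_val (x ! (l - 1))))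
      in if \<exists>m\<in>{0..n}. (\<Sum>l=m+1..n. digit_val (x ! (l - 1))) = y
         then let m = (THE m. m \<in> {0..n} \<and> (\<Sum>l=m+1..n. digit_val (x ! (l - 1))) = y)
              in 1 / (\<Prod>j=m+1..n. - (\<Sum>l=m+1..j. \<alpha> l)) *
                 (1 / (\<Prod>j=1..m. \<Sum>l=j..m. \<alpha> l))
         else 0)"

text \<open>The value at the empty word for positive third argument is irrelevant: the mathematical
  function is only defined for \<open>z \<le> length x\<close> (and \<open>y \<le> digit_sum x\<close>), and the
  recursion stays within that domain.\<close>

function yf_f :: "yf_word \<Rightarrow> nat \<Rightarrow> nat \<Rightarrow> rat" where
  "yf_f x y 0 = yf_f0 x y"
| "yf_f [] y (Suc z) = 0"
| "yf_f (x @ [One]) y (Suc z) =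
     (if y = 0 then yf_f (x @ [One]) 0 0
      else yf_f (x @ [One]) y 0 + yf_f x (y - 1) z)"
| "yf_f (x @ [Two]) y (Suc z) =
     (if y = 1 then 0
      else yf_f (x @ [One, One]) y (Suc (Suc z)) / (1 - rat_of_nat y))"
proof -
  fix P and a :: "yf_word \<times> nat \<times> nat"
  assume *: "\<And>x y. a = (x, y, 0) \<Longrightarrow> P"
    "\<And>y z. a = ([], y, Suc z) \<Longrightarrow> P"
    "\<And>x y z. a = (x @ [One], y, Suc z) \<Longrightarrow> P"
    "\<And>x y z. a = (x @ [Two], y, Suc z) \<Longrightarrow> P"
  obtain x y z where a: "a = (x, y, z)" by (cases a) auto
  show P
  proof (cases z)
    case 0
    then show ?thesis using *(1) a by simp
  next
    case (Suc z')
    show ?thesis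
    proof (cases x rule: rev_cases)
      case Nil
      then show ?thesis using *(2) a Suc by simp
    next
      case (snoc x' c)
      then show ?thesis using *(3,4) a Suc by (cases c) auto
    qed
  qed
qed auto
termination
  by (relation "measures [\<lambda>(x, y, z). digit_sum x, \<lambda>(x, y, z). num_twos x, \<lambda>(x, y, z). z]")
     (auto simp: digit_sum_def num_twos_def)

text \<open>\<open>one_runs\<close> lists the lengths of the (possibly empty) runs of ones before, between and after
  the twos, from left to right. So \<open>yf_beta y i\<close> is the exponent \<open>\<beta>\<^sub>i\<close> in
  \<open>y = 1\<^sup>\<beta>\<^sup>d 2 \<dots> 2 1\<^sup>\<beta>\<^sup>1 2 1\<^sup>\<beta>\<^sup>0\<close>.\<close>

fun one_runs :: "yf_word \<Rightarrow> nat list" where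
  "one_runs [] = [0]"
| "one_runs (One # w) = Suc (hd (one_runs w)) # tl (one_runs w)"
| "one_runs (Two # w) = 0 # one_runs w"

definition yf_beta :: "yf_word \<Rightarrow> nat \<Rightarrow> nat" where
  "yf_beta y i = rev (one_runs y) ! i"

lemma length_one_runs: "length (one_runs y) = Suc (num_twos y)"
  by (induction y rule: one_runs.induct) (auto simp: num_twos_def)

lemma one_runs_decomposition:
  "y = replicate (yf_beta y (num_twos y)) One @
       concat (map (\<lambda>i. Two # replicate (yf_beta y i) One) (rev [0..<num_twos y]))"
proof (induction y rule: one_runs.induct)
  case 1
  show ?case by (simp add: num_twos_def yf_beta_def)
next
  case (2 w)
  have len: "length (tl (one_runs w)) = num_twos w"
    by (simp add: length_one_runs)
  have cons: "one_runs w = hd (one_runs w) # tl (one_runs w)"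
    using length_one_runs[of w] by (cases "one_runs w") auto
  have d: "num_twos (One # w) = num_twos w" by (simp add: num_twos_def)
  have top: "yf_beta (One # w) (num_twos w) = Suc (yf_beta w (num_twos w))"
    using len cons by (metis length_rev nth_append_length one_runs.simps(2) rev.simps(2) yf_beta_def)
  have low: "yf_beta (One # w) i = yf_beta w i" if "i < num_twos w" for i
    using len cons that
    by (metis length_rev nth_append one_runs.simps(2) rev.simps(2) yf_beta_def)
  have m: "map (\<lambda>i. Two # replicate (yf_beta (One # w) i) One) (rev [0..<num_twos w]) =
        map (\<lambda>i. Two # replicate (yf_beta w i) One) (rev [0..<num_twos w])"
    using low by (intro map_cong) auto
  from 2(1) show ?case
    unfolding d top m replicate_Suc append_Cons by (rule arg_cong[where f = "(#) One"])
next
  case (3 w)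
  have d: "num_twos (Two # w) = Suc (num_twos w)" by (simp add: num_twos_def)
  have top: "yf_beta (Two # w) (Suc (num_twos w)) = 0"
    by (metis length_one_runs length_rev nth_append_length one_runs.simps(3) rev.simps(2)
        yf_beta_def)
  have low: "yf_beta (Two # w) i = yf_beta w i" if "i < Suc (num_twos w)" for i
    using that by (simp add: yf_beta_def nth_append length_one_runs)
  have m: "map (\<lambda>i. Two # replicate (yf_beta (Two # w) i) One) (rev [0..<Suc (num_twos w)]) =
        map (\<lambda>i. Two # replicate (yf_beta w i) One) (rev [0..<Suc (num_twos w)])"
    using low by (intro map_cong) auto
  have "Two # w = Two # replicate (yf_beta w (num_twos w)) One @
      concat (map (\<lambda>i. Two # replicate (yf_beta w i) One) (rev [0..<num_twos w]))"
    using 3 by (rule arg_cong[where f = "(#) Two"])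
  then show ?case unfolding d top m by simp
qed

definition yf_g :: "yf_word \<Rightarrow> nat \<Rightarrow> nat" where
  "yf_g y m = (\<Sum>i<m. yf_beta y i) + 2 * m - 1"

definition yf_F :: "yf_word \<Rightarrow> yf_word \<Rightarrow> nat \<Rightarrow> rat" where
  "yf_F x y i =
     yf_f x i (common_suffix_length x y) *
     (\<Prod>j=1..num_twos y. rat_of_nat (yf_g y j) - rat_of_nat i)"

definition yf_m :: "nat \<Rightarrow> nat \<Rightarrow> nat" where
  "yf_m X S = min (X div 2) S"

end

theory Submission
  imports Defs
begin

text \<open>Let \<open>U\<close> and \<open>D\<close> sum a function on words over the upper and the lower covers. They
  satisfy \<open>U D - D U = 1\<close>, so the sum of all words in \<open>s\<close> letters \<open>U\<close> and \<open>j\<close> letters \<open>D\<close> is a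
  combination, with universal coefficients, of the operators \<open>U\<^sup>a D\<^sup>b\<close>. In this form a path
  from \<open>y\<close> to \<open>x\<close> first climbs and then descends, so it stays at ranks at least \<open>|x|\<close>, where
  \<open>D F(x,_,i) = F(x,_,i)\<close> and \<open>U F(x,_,i) = (|_| + 1 - i) F(x,_,i)\<close>; moreover \<open>\<Sum>\<^sub>i F(x,_,i)\<close> is
  the indicator function of \<open>x\<close> at rank \<open>|x|\<close>. Hence the coefficient of \<open>F(x,y,i)\<close> is the weighted
  number of walks from \<open>|y| - i\<close> to \<open>|x| - i\<close> in the polynomial model (\<open>t\<close> and \<open>d/dt\<close> in the basis
  \<open>t\<^sup>b/b!\<close>), which satisfies a two-term recursion solved by the inner sum.

  For the two facts about \<open>F\<close>, split off the term \<open>f(x,i,0) \<Prod>\<^sub>j (g(y,j) - i)\<close>: the remainder has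
  a simple recursion in the last letters. Since \<open>f(x,_,0)\<close> is up to sign a divided difference of
  order \<open>#x\<close> and the product has degree \<open>d(y)\<close> in \<open>i\<close>, its sum over \<open>i\<close> vanishes for
  \<open>|x| = |y|\<close> unless \<open>x\<close> and \<open>y\<close> consist of twos only.\<close>

section \<open>Digit sums and single letters\<close>

lemma digit_sum_simps [simp]:
  "digit_sum [] = 0" "digit_sum (c # w) = digit_val c + digit_sum w"
  "digit_sum (v @ w) = digit_sum v + digit_sum w"
  by (simp_all add: digit_sum_def)

lemma num_twos_simps [simp]:
  "num_twos [] = 0" "num_twos (One # w) = num_twos w" "num_twos (Two # w) = Suc (num_twos w)"
  by (simp_all add: num_twos_def)

lemma digit_val_pos [simp]: "0 < digit_val c"
  by (cases c) auto

lemma digit_val_neq_0 [simp]: "digit_val c \<noteq> 0"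
  by (cases c) auto

lemma not_One [simp]: "c \<noteq> One \<longleftrightarrow> c = Two" "One \<noteq> c \<longleftrightarrow> c = Two"
  by (cases c; simp)+

section \<open>Covers\<close>

lemma no_yf_up_Nil: "\<not> yf_up v []"
  by (auto elim: yf_up.cases)

lemma yf_up_One_iff: "yf_up v (One # w) \<longleftrightarrow> v = w"
proof
  assume "yf_up v (One # w)"
  then show "v = w"
    by (auto elim!: yf_up.cases simp: Cons_eq_append_conv)
next
  assume "v = w"
  then show "yf_up v (One # w)" using yf_up.insert[of "[]" w] by simp
qed

lemma yf_up_Two_iff: "yf_up v (Two # w) \<longleftrightarrow> v = One # w \<or> (\<exists>u. v = Two # u \<and> yf_up u w)"
proof
  assume "yf_up v (Two # w)"
  then show "v = One # w \<or> (\<exists>u. v = Two # u \<and> yf_up u w)"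
  proof cases
    case (replace p q)
    then show ?thesis using yf_up.replace[of "tl p" q] by (cases p) auto
  next
    case (insert p q)
    then show ?thesis using yf_up.insert[of "tl p" q] by (cases p) auto
  qed
next
  assume "v = One # w \<or> (\<exists>u. v = Two # u \<and> yf_up u w)"
  then show "yf_up v (Two # w)"
  proof (elim disjE exE conjE)
    assume "v = One # w"
    then show ?thesis using yf_up.replace[of "[]" w] by simp
  next
    fix u assume "v = Two # u" "yf_up u w"
    from this(2,1) show ?thesis
    proof cases
      case (replace p q)
      then show ?thesis using \<open>v = Two # u\<close> yf_up.replace[of "Two # p" q] by simp
    next
      case (insert p q)
      then show ?thesis using \<open>v = Two # u\<close> yf_up.insert[of "Two # p" q] by simp
    qed
  qed
qed

text \<open>Comparison with \<open>yf_up_Two_iff\<close> shows a reflection: the upper covers of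
  \<open>w\<close> are exactly the lower covers of \<open>Two # w\<close>. The commutation relation
  rests on this.\<close>

lemma yf_up_iff: "yf_up w u \<longleftrightarrow> u = One # w \<or> (\<exists>v. u = Two # v \<and> yf_up v w)"
proof (induction u arbitrary: w rule: one_runs.induct)
  case (3 u)
  show ?case
    using 3[of "tl w"]
    by (cases w rule: one_runs.cases) (auto simp: yf_up_Two_iff yf_up_One_iff no_yf_up_Nil)
qed (auto simp: no_yf_up_Nil yf_up_One_iff)

lemma digit_sum_yf_up: "yf_up v w \<Longrightarrow> digit_sum w = Suc (digit_sum v)"
  by (induction rule: yf_up.induct) auto

lemma lower_covers:
  "{v. yf_up v []} = {}"
  "{v. yf_up v (One # w)} = {w}"
  "{v. yf_up v (Two # w)} = insert (One # w) ((#) Two ` {v. yf_up v w})"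
  by (auto simp: no_yf_up_Nil yf_up_One_iff yf_up_Two_iff)

lemma upper_covers: "{u. yf_up w u} = insert (One # w) ((#) Two ` {v. yf_up v w})"
  using yf_up_iff[of w] by blast

lemma finite_lower_covers [simp]: "finite {v. yf_up v w}"
  by (induction w rule: one_runs.induct) (auto simp: lower_covers)

lemma finite_upper_covers [simp]: "finite {u. yf_up w u}"
  by (simp add: upper_covers)

section \<open>The up and down operators\<close>

definition down_sum :: "(yf_word \<Rightarrow> rat) \<Rightarrow> yf_word \<Rightarrow> rat" where
  "down_sum \<phi> w = (\<Sum>v | yf_up v w. \<phi> v)"

definition up_sum :: "(yf_word \<Rightarrow> rat) \<Rightarrow> yf_word \<Rightarrow> rat" where
  "up_sum \<phi> w = (\<Sum>u | yf_up w u. \<phi> u)"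

lemma down_sum_simps [simp]:
  "down_sum \<phi> [] = 0"
  "down_sum \<phi> (One # w) = \<phi> w"
  "down_sum \<phi> (Two # w) = \<phi> (One # w) + down_sum (\<lambda>v. \<phi> (Two # v)) w"
proof -
  show "down_sum \<phi> (Two # w) = \<phi> (One # w) + down_sum (\<lambda>v. \<phi> (Two # v)) w"
    unfolding down_sum_def lower_covers
    by (subst sum.insert) (auto simp: sum.reindex)
qed (simp_all add: down_sum_def lower_covers)

lemma up_sum_eq_down_sum: "up_sum \<phi> w = down_sum \<phi> (Two # w)"
  by (simp only: up_sum_def down_sum_def lower_covers upper_covers)

lemma down_sum_cong:
  "(\<And>v. digit_sum w = Suc (digit_sum v) \<Longrightarrow> \<phi> v = \<psi> v) \<Longrightarrow> down_sum \<phi> w = down_sum \<psi> w"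
  unfolding down_sum_def using digit_sum_yf_up by (intro sum.cong) auto

lemma down_sum_linear: "down_sum (\<lambda>v. a * \<phi> v + \<psi> v) w = a * down_sum \<phi> w + down_sum \<psi> w"
  by (simp add: down_sum_def sum.distrib sum_distrib_left)

lemma down_sum_mult: "down_sum (\<lambda>v. a * \<phi> v) w = a * down_sum \<phi> w"
  by (simp add: down_sum_def sum_distrib_left)

lemma down_sum_zero [simp]: "down_sum (\<lambda>v. 0) w = 0"
  by (simp add: down_sum_def)

text \<open>A step down changes or deletes a letter with no One to its left, so it can reach the
  last letter only if \<open>w\<close> has no One; every other step stays inside
  \<open>w\<close>.\<close>

lemma down_sum_snoc_One:
  "down_sum \<phi> (w @ [One]) = down_sum (\<lambda>v. \<phi> (v @ [One])) w + (if One \<in> set w then 0 else \<phi> w)"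
  by (induction w arbitrary: \<phi> rule: one_runs.induct) auto

lemma down_sum_snoc_Two:
  "down_sum \<phi> (w @ [Two]) =
    down_sum (\<lambda>v. \<phi> (v @ [Two])) w + (if One \<in> set w then 0 else \<phi> (w @ [One]))"
  by (induction w arbitrary: \<phi> rule: one_runs.induct) auto

section \<open>Normal ordering\<close>

locale weyl_operators =
  fixes U D :: "('a \<Rightarrow> rat) \<Rightarrow> 'a \<Rightarrow> rat"
  assumes U_linear: "U (\<lambda>y. a * \<phi> y + \<psi> y) = (\<lambda>y. a * U \<phi> y + U \<psi> y)"
    and D_linear: "D (\<lambda>y. a * \<phi> y + \<psi> y) = (\<lambda>y. a * D \<phi> y + D \<psi> y)"
    and commutator: "U (D \<phi>) = (\<lambda>y. D (U \<phi>) y + \<phi> y)"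
begin

text \<open>The sum, applied to \<open>\<phi>\<close>, of all products of \<open>n\<close> letters
  of which \<open>s\<close> are \<open>U\<close> and the others \<open>D\<close>. The recursion
  splits off the outermost letter, which is the first step of a path that starts at
  \<open>y\<close>.\<close>

primrec words :: "nat \<Rightarrow> nat \<Rightarrow> ('a \<Rightarrow> rat) \<Rightarrow> 'a \<Rightarrow> rat" where
  "words 0 s \<phi> = (\<lambda>y. if s = 0 then \<phi> y else 0)"
| "words (Suc n) s \<phi> =
     (\<lambda>y. D (words n s \<phi>) y + (if s = 0 then 0 else U (words n (s - 1) \<phi>) y))"

end

text \<open>The coefficient of \<open>U^(s-k) D^(n-s-k)\<close> in that sum after normal ordering.
  The negative term comes from \<open>D U^a = U^a D - a U^(a-1)\<close> with
  \<open>a = s - k + 1\<close>.\<close>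

fun order_coeff :: "nat \<Rightarrow> nat \<Rightarrow> nat \<Rightarrow> rat" where
  "order_coeff 0 s k = (if s = 0 \<and> k = 0 then 1 else 0)"
| "order_coeff (Suc n) s k =
     order_coeff n s k + (if s = 0 then 0 else order_coeff n (s - 1) k)
     - (if k = 0 then 0 else (of_nat s - of_nat k + 1) * order_coeff n s (k - 1))"

text \<open>At these indices an exponent of \<open>U\<close> or \<open>D\<close> would be negative;
  the vanishing makes the truncated subtractions in the exponents harmless.\<close>

lemma order_coeff_eq_0: "s < k \<or> n < s + k \<Longrightarrow> order_coeff n s k = 0"
proof (induction n s k rule: order_coeff.induct)
  case (2 n s k)
  show ?case
  proof (cases "k = Suc s")
    \<comment> \<open>The factor \<open>s - k + 1\<close> is zero here, so
      \<open>order_coeff n s s\<close> does not contribute.\<close>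
    case True
    then show ?thesis using 2 by (cases s) auto
  next
    case False
    with 2(4) have "s < k - 1 \<or> n < s + (k - 1)" if "k \<noteq> 0"
      using that by linarith
    with 2 show ?thesis by (cases s) auto
  qed
qed auto

context weyl_operators
begin

lemma U_zero: "U (\<lambda>y. 0) = (\<lambda>y. 0)"
  using U_linear[of "-1" "\<lambda>y. 0" "\<lambda>y. 0"] by simp

lemma D_zero: "D (\<lambda>y. 0) = (\<lambda>y. 0)"
  using D_linear[of "-1" "\<lambda>y. 0" "\<lambda>y. 0"] by simp

lemma U_diff: "U (\<lambda>y. \<phi> y - a * \<psi> y) = (\<lambda>y. U \<phi> y - a * U \<psi> y)"
  using U_linear[of "- a" \<psi> \<phi>] by simp

lemma U_sum: "finite A \<Longrightarrow> U (\<lambda>y. \<Sum>k\<in>A. a k * \<phi> k y) = (\<lambda>y. \<Sum>k\<in>A. a k * U (\<phi> k) y)"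
  by (induction A rule: finite_induct) (simp_all add: U_zero U_linear)

lemma D_sum: "finite A \<Longrightarrow> D (\<lambda>y. \<Sum>k\<in>A. a k * \<phi> k y) = (\<lambda>y. \<Sum>k\<in>A. a k * D (\<phi> k) y)"
  by (induction A rule: finite_induct) (simp_all add: D_zero D_linear)

lemma D_U_power:
  "D ((U ^^ s) \<phi>) = (\<lambda>y. (U ^^ s) (D \<phi>) y - of_nat s * (U ^^ (s - 1)) \<phi> y)"
proof (induction s)
  case (Suc s)
  have *: "U (\<lambda>y. (U ^^ s) (D \<phi>) y - of_nat s * (U ^^ (s - 1)) \<phi> y) =
      (\<lambda>y. (U ^^ Suc s) (D \<phi>) y - of_nat s * (U ^^ s) \<phi> y)"
    unfolding U_diff by (cases s) simp_all
  have "D ((U ^^ Suc s) \<phi>) y = U (D ((U ^^ s) \<phi>)) y - (U ^^ s) \<phi> y" for y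
    using fun_cong[OF commutator[of "(U ^^ s) \<phi>"], of y] by simp
  then show ?case by (simp only: Suc.IH *) (simp add: algebra_simps)
qed simp

text \<open>A new \<open>D\<close> in front is moved past \<open>U^(s-k)\<close> by
  \<open>D_U_power\<close>, which contributes to the terms \<open>k\<close> and
  \<open>k + 1\<close>; a new \<open>U\<close> in front is already in order.\<close>

lemma words_eq:
  "words n s \<phi> = (\<lambda>y. \<Sum>k\<le>s. order_coeff n s k * (U ^^ (s - k)) ((D ^^ (n - s - k)) \<phi>) y)"
proof (induction n arbitrary: s)
  case 0
  show ?case by (cases "s = 0") auto
next
  case (Suc n)
  define E where "E k = (U ^^ (s - k)) ((D ^^ (Suc n - s - k)) \<phi>)" for k
  have D: "D (words n s \<phi>) y = (\<Sum>k\<le>s. order_coeff n s k * E k y)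
      - (\<Sum>k\<le>s. (if k = 0 then 0 else (of_nat s - of_nat k + 1) * order_coeff n s (k - 1)) * E k y)"
    for y
  proof -
    have "D (words n s \<phi>) y = (\<Sum>k\<le>s. order_coeff n s k *
        D ((U ^^ (s - k)) ((D ^^ (n - s - k)) \<phi>)) y)"
      by (simp add: Suc.IH D_sum)
    also have "\<dots> = (\<Sum>k\<le>s. order_coeff n s k * E k y
        - order_coeff n s k * of_nat (s - k) * E (Suc k) y)"
    proof (intro sum.cong refl)
      fix k assume "k \<in> {..s}"
      show "order_coeff n s k * D ((U ^^ (s - k)) ((D ^^ (n - s - k)) \<phi>)) y =
        order_coeff n s k * E k y - order_coeff n s k * of_nat (s - k) * E (Suc k) y"
      \<comment> \<open>Only in this range is \<open>Suc n - s - k\<close> the successor of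
        \<open>n - s - k\<close>; elsewhere the coefficient vanishes.\<close>
      proof (cases "s + k \<le> n")
        case True
        then have "Suc n - s - k = Suc (n - s - k)" by simp
        then show ?thesis by (simp add: D_U_power E_def algebra_simps)
      qed (simp add: order_coeff_eq_0)
    qed
    also have "\<dots> = (\<Sum>k\<le>s. order_coeff n s k * E k y)
        - (\<Sum>k\<le>s. order_coeff n s k * of_nat (s - k) * E (Suc k) y)"
      by (simp add: sum_subtractf)
    \<comment> \<open>Index shift; the added top term \<open>k = Suc s\<close> carries the factor
      zero, so the range can return to \<open>k \<le> s\<close>.\<close>
    also have "(\<Sum>k\<le>s. order_coeff n s k * of_nat (s - k) * E (Suc k) y) =
        (\<Sum>k\<le>Suc s. (if k = 0 then 0 else (of_nat s - of_nat k + 1) * order_coeff n s (k - 1)) * E k y)"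
      unfolding sum.atMost_Suc_shift by (simp add: of_nat_diff mult.commute)
    finally show ?thesis by simp
  qed
  have U: "U (words n (s - 1) \<phi>) y = (\<Sum>k\<le>s. order_coeff n (s - 1) k * E k y)" if "s \<noteq> 0" for y
  proof -
    have "U (words n (s - 1) \<phi>) y = (\<Sum>k\<le>s - 1. order_coeff n (s - 1) k *
        U ((U ^^ (s - 1 - k)) ((D ^^ (n - (s - 1) - k)) \<phi>)) y)"
      by (simp add: Suc.IH U_sum)
    also have "\<dots> = (\<Sum>k\<le>s - 1. order_coeff n (s - 1) k * E k y)"
    proof (intro sum.cong refl)
      fix k assume "k \<in> {..s - 1}"
      then have "s - k = Suc (s - 1 - k)" "n - (s - 1) - k = Suc n - s - k"
        using that by auto
      then show "order_coeff n (s - 1) k * U ((U ^^ (s - 1 - k)) ((D ^^ (n - (s - 1) - k)) \<phi>)) y =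
          order_coeff n (s - 1) k * E k y"
        by (simp add: E_def)
    qed
    also have "\<dots> = (\<Sum>k\<le>s. order_coeff n (s - 1) k * E k y)"
      using that by (cases s) (simp_all add: order_coeff_eq_0)
    finally show ?thesis .
  qed
  show ?case
  proof
    fix y
    have "words (Suc n) s \<phi> y = (\<Sum>k\<le>s. order_coeff (Suc n) s k * E k y)"
      using D[of y] U[of y]
      by (cases "s = 0") (simp_all add: algebra_simps sum.distrib sum_subtractf)
    then show "words (Suc n) s \<phi> y = (\<Sum>k\<le>s. order_coeff (Suc n) s k *
        (U ^^ (s - k)) ((D ^^ (Suc n - s - k)) \<phi>) y)"
      by (simp only: E_def)
  qed
qed

end

section \<open>Words and polynomials as instances\<close>

lemma up_sum_cong:
  "(\<And>v. digit_sum v = Suc (digit_sum w) \<Longrightarrow> \<phi> v = \<psi> v) \<Longrightarrow> up_sum \<phi> w = up_sum \<psi> w"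
  unfolding up_sum_def using digit_sum_yf_up by (intro sum.cong) auto

interpretation yf: weyl_operators up_sum down_sum
proof
  fix \<phi> :: "yf_word \<Rightarrow> rat"
  \<comment> \<open>By reflection the left side is \<open>down_sum (down_sum \<phi>)\<close> at
    \<open>Two # y\<close>; its lower cover \<open>One # y\<close> yields the extra
    \<open>\<phi> y\<close>.\<close>
  show "up_sum (down_sum \<phi>) = (\<lambda>y. down_sum (up_sum \<phi>) y + \<phi> y)"
    by (auto simp: up_sum_eq_down_sum[abs_def])
qed (auto simp: up_sum_eq_down_sum down_sum_linear simp del: down_sum_simps)

text \<open>The argument \<open>b\<close> stands for \<open>|y| - i\<close>. The weights
  \<open>Suc b\<close> upwards and 1 downwards are the factors in \<open>up_sum_yf_F\<close> and
  \<open>down_sum_yf_F\<close>.\<close>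

definition poly_up :: "(nat \<Rightarrow> rat) \<Rightarrow> nat \<Rightarrow> rat" where
  "poly_up \<phi> b = of_nat (Suc b) * \<phi> (Suc b)"

definition poly_down :: "(nat \<Rightarrow> rat) \<Rightarrow> nat \<Rightarrow> rat" where
  "poly_down \<phi> b = (if b = 0 then 0 else \<phi> (b - 1))"

interpretation poly: weyl_operators poly_up poly_down
  by standard (auto simp: poly_up_def poly_down_def fun_eq_iff algebra_simps)

lemma poly_up_power: "(poly_up ^^ s) \<phi> b = fact (b + s) / fact b * \<phi> (b + s)"
proof (induction s arbitrary: b)
  case (Suc s)
  have "(poly_up ^^ Suc s) \<phi> b = of_nat (Suc b) * (fact (Suc b + s) / fact (Suc b) * \<phi> (Suc b + s))"
    by (simp only: funpow.simps comp_def poly_up_def Suc.IH)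
  also have "\<dots> = fact (b + Suc s) / fact b * \<phi> (b + Suc s)"
    by (simp only: fact_Suc[of b]) (simp del: fact_Suc of_nat_Suc)
  finally show ?case .
qed simp

lemma poly_down_power: "(poly_down ^^ j) \<phi> b = (if j \<le> b then \<phi> (b - j) else 0)"
  by (induction j arbitrary: b) (auto simp: poly_down_def)

text \<open>By the balance of degrees, \<open>s - k\<close> steps up and \<open>n - s - k\<close>
  steps down from \<open>b\<close> end exactly at \<open>a\<close>, so the indicator is 1 in every
  term with a nonzero coefficient.\<close>

lemma poly_words_delta:
  assumes "b + 2 * s = a + n"
  shows "poly.words n s (\<lambda>c. if c = a then 1 else 0) b =
    (\<Sum>k\<le>s. order_coeff n s k * (fact (b + (s - k)) / fact b))"
proof -
  have "order_coeff n s k * (poly_up ^^ (s - k)) ((poly_down ^^ (n - s - k)) (\<lambda>c. if c = a then 1 else 0)) b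
      = order_coeff n s k * (fact (b + (s - k)) / fact b)" if "k \<le> s" for k
  proof (cases "s + k \<le> n")
    case True
    then have "n - s - k \<le> b + (s - k)" "b + (s - k) - (n - s - k) = a"
      using that assms by linarith+
    then show ?thesis by (simp add: poly_up_power poly_down_power)
  qed (simp add: order_coeff_eq_0)
  then show ?thesis unfolding poly.words_eq by (intro sum.cong) auto
qed

section \<open>Suffix sums\<close>

text \<open>The support of \<open>yf_f0 x\<close>, and the nodes of the divided difference
  below.\<close>

definition suffix_sums :: "yf_word \<Rightarrow> nat set" where
  "suffix_sums x = {digit_sum s | s. suffix s x}"

lemma suffix_sums_Nil [simp]: "suffix_sums [] = {0}"
  by (auto simp: suffix_sums_def)

lemma suffix_sums_Cons [simp]:
  "suffix_sums (c # x) = insert (digit_sum (c # x)) (suffix_sums x)"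
  by (force simp: suffix_sums_def suffix_Cons)

lemma suffix_sums_snoc:
  "suffix_sums (x @ [c]) = insert 0 ((+) (digit_val c) ` suffix_sums x)"
  by (induction x) (auto simp: add.commute)

lemma finite_suffix_sums [simp]: "finite (suffix_sums x)"
  by (induction x) auto

lemma suffix_sums_le: "i \<in> suffix_sums x \<Longrightarrow> i \<le> digit_sum x"
  by (induction x) auto

lemma suffix_sums_eq_image: "suffix_sums x = (\<lambda>j. digit_sum (drop j x)) ` {0..length x}"
proof -
  have "suffix s x \<longleftrightarrow> (\<exists>j\<in>{0..length x}. s = drop j x)" for s
  proof
    assume "suffix s x"
    then obtain p where "x = p @ s" by (auto simp: suffix_def)
    then show "\<exists>j\<in>{0..length x}. s = drop j x" by (intro bexI[of _ "length p"]) auto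
  qed (auto simp: suffix_drop)
  then show ?thesis by (auto simp: suffix_sums_def)
qed

lemma sum_digits_eq_diff:
  assumes "j \<le> k" "k \<le> length x"
  shows "(\<Sum>l=j+1..k. digit_val (x ! (l - 1))) + digit_sum (drop k x) = digit_sum (drop j x)"
  using assms
proof (induction k rule: dec_induct)
  case (step k)
  have "drop k x = x ! k # drop (Suc k) x"
    using step by (simp add: Cons_nth_drop_Suc)
  then show ?case using step by simp
qed simp

lemma inj_on_digit_sum_drop: "inj_on (\<lambda>j. digit_sum (drop j x)) {0..length x}"
proof (rule linorder_inj_onI)
  fix j k assume jk: "j < k" "j \<in> {0..length x}" "k \<in> {0..length x}"
  have "digit_val (x ! (k - 1)) \<le> (\<Sum>l=j+1..k. digit_val (x ! (l - 1)))"
    using jk by (intro member_le_sum) auto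
  moreover have "(\<Sum>l=j+1..k. digit_val (x ! (l - 1))) + digit_sum (drop k x) = digit_sum (drop j x)"
    using jk by (intro sum_digits_eq_diff) auto
  ultimately show "digit_sum (drop j x) \<noteq> digit_sum (drop k x)"
    using digit_val_pos[of "x ! (k - 1)"] by linarith
qed auto

text \<open>Up to the sign \<open>(-1)\<^sup>n\<close>, \<open>yf_f0 x\<close> lists the weights of the divided difference at the suffix
  sums of \<open>x\<close>.\<close>

lemma yf_f0_eq_prod:
  "yf_f0 x i = (if i \<in> suffix_sums x
     then \<Prod>t\<in>suffix_sums x - {i}. 1 / (rat_of_nat t - rat_of_nat i) else 0)"
proof -
  define n where "n = length x"
  define t where "t j = digit_sum (drop j x)" for j
  have T: "suffix_sums x = t ` {0..n}"
    by (simp add: suffix_sums_eq_image t_def n_def)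
  have inj: "inj_on t {0..n}"
    using inj_on_digit_sum_drop[of x] by (simp add: t_def[abs_def] n_def)
  \<comment> \<open>Sums of consecutive digits are differences of nodes, so the two products in the
    definition run over the factors \<open>t j - i\<close> with \<open>j > m\<close> and with
    \<open>j < m\<close>.\<close>
  have diff: "(\<Sum>l=j+1..k. digit_val (x ! (l - 1))) + t k = t j" if "j \<le> k" "k \<le> n" for j k
    using sum_digits_eq_diff that by (simp add: t_def n_def)
  have diff': "(\<Sum>l=j+1..k. rat_of_nat (digit_val (x ! (l - 1)))) = of_nat (t j) - of_nat (t k)"
    if "j \<le> k" "k \<le> n" for j k
  proof -
    have "rat_of_nat (\<Sum>l=j+1..k. digit_val (x ! (l - 1))) + of_nat (t k) = of_nat (t j)"
      using diff[OF that] unfolding of_nat_add[symmetric] by (rule arg_cong)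
    then show ?thesis unfolding of_nat_sum by linarith
  qed
  have tn: "t n = 0" by (simp add: t_def n_def)
  have split: "(\<Sum>l=m+1..n. digit_val (x ! (l - 1))) = i \<longleftrightarrow> t m = i" if "m \<in> {0..n}" for m
    using diff[of m n] that tn by simp
  show ?thesis
  proof (cases "i \<in> suffix_sums x")
    case True
    then obtain m where m: "m \<in> {0..n}" "t m = i" unfolding T by auto
    have the: "(THE m. m \<in> {0..n} \<and> (\<Sum>l=m+1..n. digit_val (x ! (l - 1))) = i) = m"
      using m split by (intro the_equality) (auto simp: inj_on_eq_iff[OF inj])
    have ex: "\<exists>m\<in>{0..n}. (\<Sum>l=m+1..n. digit_val (x ! (l - 1))) = i"
      using m split by blast
    have "yf_f0 x i = 1 / (\<Prod>j=m+1..n. - (\<Sum>l=m+1..j. rat_of_nat (digit_val (x ! (l - 1))))) *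
        (1 / (\<Prod>j=1..m. \<Sum>l=j..m. rat_of_nat (digit_val (x ! (l - 1)))))"
      using ex the unfolding yf_f0_def Let_def n_def by simp
    also have "(\<Prod>j=m+1..n. - (\<Sum>l=m+1..j. rat_of_nat (digit_val (x ! (l - 1))))) =
        (\<Prod>j=m+1..n. of_nat (t j) - of_nat i)"
      using m by (intro prod.cong) (auto simp: diff'[simplified])
    also have "(\<Prod>j=1..m. \<Sum>l=j..m. rat_of_nat (digit_val (x ! (l - 1)))) =
        (\<Prod>j=1..m. of_nat (t (j - 1)) - of_nat i)"
    proof (intro prod.cong refl)
      fix j assume "j \<in> {1..m}"
      then have "j - 1 \<le> m" "m \<le> n" "j - 1 + 1 = j" using m by auto
      then show "(\<Sum>l=j..m. rat_of_nat (digit_val (x ! (l - 1)))) = of_nat (t (j - 1)) - of_nat i"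
        using m diff'[of "j - 1" m] by metis
    qed
    also have "(\<Prod>j=1..m. rat_of_nat (t (j - 1)) - of_nat i) = (\<Prod>j\<in>{0..<m}. of_nat (t j) - of_nat i)"
      by (rule prod.reindex_bij_witness[of _ Suc "\<lambda>j. j - 1"]) auto
    also have "1 / (\<Prod>j=m+1..n. rat_of_nat (t j) - of_nat i) *
        (1 / (\<Prod>j\<in>{0..<m}. of_nat (t j) - of_nat i)) =
        (\<Prod>j\<in>{0..<m} \<union> {m+1..n}. 1 / (of_nat (t j) - of_nat i))"
      by (subst prod.union_disjoint) (auto simp: prod_dividef)
    also have "{0..<m} \<union> {m+1..n} = {0..n} - {m}"
      using m by auto
    also have "(\<Prod>j\<in>{0..n} - {m}. 1 / (rat_of_nat (t j) - of_nat i)) =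
        (\<Prod>s\<in>t ` ({0..n} - {m}). 1 / (of_nat s - of_nat i))"
      using inj by (subst prod.reindex) (auto intro: inj_on_subset)
    also have "t ` ({0..n} - {m}) = suffix_sums x - {i}"
      unfolding T using inj m by (auto dest: inj_onD)
    finally show ?thesis using True by simp
  next
    case False
    then have "t m \<noteq> i" if "m \<in> {0..n}" for m
      using that unfolding T by blast
    then have "\<not> (\<exists>m\<in>{0..n}. (\<Sum>l=m+1..n. digit_val (x ! (l - 1))) = i)"
      using split by (metis (no_types))
    then have "yf_f0 x i = 0" unfolding yf_f0_def Let_def n_def by simp
    with False show ?thesis by simp
  qed
qed

lemma yf_f0_Nil: "yf_f0 [] i = (if i = 0 then 1 else 0)"
  by (simp add: yf_f0_eq_prod)

text \<open>The first letter adds one node, larger than all others, whose factor cancels against the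
  prefactor. The assumption keeps \<open>i\<close> away from the new node.\<close>

lemma yf_f0_Cons:
  assumes "i \<le> digit_sum x"
  shows "(rat_of_nat (digit_sum (c # x)) - rat_of_nat i) * yf_f0 (c # x) i = yf_f0 x i"
proof -
  have n: "digit_sum (c # x) \<notin> suffix_sums x" "i \<noteq> digit_sum (c # x)"
    using suffix_sums_le[of "digit_sum (c # x)" x] digit_val_pos[of c] assms by auto
  then have "suffix_sums (c # x) - {i} = insert (digit_sum (c # x)) (suffix_sums x - {i})"
    by auto
  then show ?thesis
    using n by (simp add: yf_f0_eq_prod field_simps flip: of_nat_add)
qed

text \<open>The last letter shifts all nodes by its value and adds the node 0, whose factor is
  \<open>1 / (0 - i)\<close>.\<close>

lemma yf_f0_snoc:
  "rat_of_nat i * yf_f0 (x @ [c]) i = (if digit_val c \<le> i then - yf_f0 x (i - digit_val c) else 0)"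
proof (cases "i = 0")
  case True
  then show ?thesis by simp
next
  case False
  show ?thesis
  proof (cases "digit_val c \<le> i \<and> i - digit_val c \<in> suffix_sums x")
    case True
    define k where "k = i - digit_val c"
    have i: "i = digit_val c + k" and k: "k \<in> suffix_sums x" using True by (simp_all add: k_def)
    have T: "suffix_sums (x @ [c]) - {i} = insert 0 ((+) (digit_val c) ` (suffix_sums x - {k}))"
      unfolding suffix_sums_snoc i using digit_val_pos[of c] by auto
    have "yf_f0 (x @ [c]) i = 1 / (- rat_of_nat i) *
        (\<Prod>t\<in>(+) (digit_val c) ` (suffix_sums x - {k}). 1 / (of_nat t - of_nat i))"
      using k unfolding yf_f0_eq_prod T
      by (subst prod.insert) (auto simp: suffix_sums_snoc i image_iff)
    also have "(\<Prod>t\<in>(+) (digit_val c) ` (suffix_sums x - {k}). 1 / (rat_of_nat t - of_nat i)) =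
        (\<Prod>t\<in>suffix_sums x - {k}. 1 / (of_nat t - of_nat k))"
      by (subst prod.reindex) (auto simp: i)
    also have "\<dots> = yf_f0 x k" using k by (simp add: yf_f0_eq_prod)
    finally show ?thesis using True False by (simp add: k_def)
  next
    case no: False
    then have "i \<notin> suffix_sums (x @ [c])" using False by (auto simp: suffix_sums_snoc)
    with no show ?thesis by (auto simp: yf_f0_eq_prod)
  qed
qed

section \<open>Divided differences\<close>

text \<open>This is \<open>(-1)^(length x)\<close> times the divided difference of \<open>p\<close>
  at the suffix sums of \<open>x\<close>.\<close>

definition f0_eval :: "yf_word \<Rightarrow> (rat \<Rightarrow> rat) \<Rightarrow> rat" where
  "f0_eval x p = (\<Sum>i\<le>digit_sum x. yf_f0 x i * p (of_nat i))"

lemma f0_eval_Cons: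
  "f0_eval (c # x) (\<lambda>t. (rat_of_nat (digit_sum (c # x)) - t) * p t) = f0_eval x p"
proof -
  have "f0_eval (c # x) (\<lambda>t. (rat_of_nat (digit_sum (c # x)) - t) * p t) =
     (\<Sum>i\<le>digit_sum x. yf_f0 (c # x) i * ((rat_of_nat (digit_sum (c # x)) - of_nat i) * p (of_nat i)))"
    unfolding f0_eval_def
  proof (rule sum.mono_neutral_right)
    show "\<forall>i\<in>{..digit_sum (c # x)} - {..digit_sum x}.
       yf_f0 (c # x) i * ((rat_of_nat (digit_sum (c # x)) - of_nat i) * p (of_nat i)) = 0"
    proof
      fix i assume i: "i \<in> {..digit_sum (c # x)} - {..digit_sum x}"
      show "yf_f0 (c # x) i * ((rat_of_nat (digit_sum (c # x)) - of_nat i) * p (of_nat i)) = 0"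
        using i suffix_sums_le[of i x] by (cases "i = digit_sum (c # x)") (auto simp: yf_f0_eq_prod)
    qed
  qed auto
  also have "\<dots> = f0_eval x p"
    unfolding f0_eval_def
  proof (intro sum.cong refl)
    fix i assume "i \<in> {..digit_sum x}"
    then show "yf_f0 (c # x) i * ((rat_of_nat (digit_sum (c # x)) - of_nat i) * p (of_nat i)) =
        yf_f0 x i * p (of_nat i)"
      using yf_f0_Cons[of i x c] by (simp add: mult.commute mult.left_commute)
  qed
  finally show ?thesis .
qed

lemma f0_eval_snoc:
  "f0_eval (x @ [c]) (\<lambda>t. t * p t) = - f0_eval x (\<lambda>t. p (t + of_nat (digit_val c)))"
proof -
  have "f0_eval (x @ [c]) (\<lambda>t. t * p t) =
      (\<Sum>i\<in>{digit_val c..digit_sum x + digit_val c}. - yf_f0 x (i - digit_val c) * p (of_nat i))"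
    unfolding f0_eval_def
  proof (rule sum.mono_neutral_cong_right)
    show "\<forall>i\<in>{..digit_sum (x @ [c])} - {digit_val c..digit_sum x + digit_val c}.
       yf_f0 (x @ [c]) i * (rat_of_nat i * p (of_nat i)) = 0"
    proof
      fix i assume "i \<in> {..digit_sum (x @ [c])} - {digit_val c..digit_sum x + digit_val c}"
      then have "rat_of_nat i * yf_f0 (x @ [c]) i = 0" unfolding yf_f0_snoc by auto
      then show "yf_f0 (x @ [c]) i * (rat_of_nat i * p (of_nat i)) = 0" by auto
    qed
  next
    fix i assume "i \<in> {digit_val c..digit_sum x + digit_val c}"
    then have "rat_of_nat i * yf_f0 (x @ [c]) i = - yf_f0 x (i - digit_val c)"
      by (simp add: yf_f0_snoc)
    then show "yf_f0 (x @ [c]) i * (rat_of_nat i * p (of_nat i)) =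
        - yf_f0 x (i - digit_val c) * p (of_nat i)"
      by (metis mult.assoc mult.commute)
  qed auto
  also have "\<dots> = (\<Sum>i\<le>digit_sum x. - yf_f0 x i * p (of_nat i + of_nat (digit_val c)))"
    by (rule sum.reindex_bij_witness[of _ "\<lambda>i. i + digit_val c" "\<lambda>i. i - digit_val c"]) auto
  also have "\<dots> = - f0_eval x (\<lambda>t. p (t + of_nat (digit_val c)))"
    by (simp add: f0_eval_def sum_negf)
  finally show ?thesis .
qed

lemma f0_eval_add: "f0_eval x (\<lambda>t. p t + q t) = f0_eval x p + f0_eval x q"
  by (simp add: f0_eval_def algebra_simps sum.distrib)

lemma f0_eval_mult: "f0_eval x (\<lambda>t. a * p t) = a * f0_eval x p"
  by (simp add: f0_eval_def sum_distrib_left mult.left_commute)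

lemma f0_eval_const: "f0_eval x (\<lambda>t. 1) = (if x = [] then 1 else 0)"
proof (induction "length x" arbitrary: x rule: less_induct)
  case less
  show ?case
  proof (cases x)
    case Nil
    then show ?thesis by (simp add: f0_eval_def yf_f0_Nil)
  next
    case (Cons c u)
    have x: "x = butlast x @ [last x]" using Cons by simp
    have N: "rat_of_nat (digit_sum x) \<noteq> 0"
      using Cons digit_val_pos[of c] by (simp del: digit_val_pos flip: of_nat_add)
    \<comment> \<open>The constant \<open>|x|\<close> is written as \<open>(|x| - t) + t\<close>:
      the summands remove the largest and the smallest node, and by induction their contributions
      cancel.\<close>
    have "rat_of_nat (digit_sum x) * f0_eval x (\<lambda>t. 1) =
        f0_eval x (\<lambda>t. (rat_of_nat (digit_sum x) - t) * 1) + f0_eval x (\<lambda>t. t * 1)"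
      unfolding f0_eval_mult[symmetric] f0_eval_add[symmetric] by simp
    also have "f0_eval x (\<lambda>t. (rat_of_nat (digit_sum x) - t) * 1) = f0_eval u (\<lambda>t. 1)"
      unfolding Cons by (rule f0_eval_Cons)
    also have "f0_eval x (\<lambda>t. t * 1) = - f0_eval (butlast x) (\<lambda>t. 1)"
      by (subst x) (rule f0_eval_snoc)
    also have "f0_eval u (\<lambda>t. 1) = f0_eval (butlast x) (\<lambda>t. 1)"
      using less[of u] less[of "butlast x"] Cons by (cases u) auto
    finally show ?thesis using N Cons by simp
  qed
qed

text \<open>A divided difference of order \<open>n\<close> annihilates lower degrees and returns the
  leading coefficient in degree \<open>n\<close>; the sign of that coefficient cancels the one in
  \<open>yf_f0\<close>.\<close>

lemma f0_eval_prod_list: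
  "length gs \<le> length x \<Longrightarrow>
    f0_eval x (\<lambda>t. \<Prod>g\<leftarrow>gs. g - t) = (if length gs = length x then 1 else 0)"
proof (induction gs arbitrary: x)
  case Nil
  then show ?case by (simp add: f0_eval_const)
next
  case (Cons g gs)
  then obtain c u where x: "x = c # u" by (cases x) auto
  let ?n = "rat_of_nat (digit_sum x)" and ?p = "\<lambda>t. \<Prod>g\<leftarrow>gs. g - t"
  \<comment> \<open>With \<open>g - t = (|x| - t) + (g - |x|)\<close>, the first summand shortens
    \<open>x\<close> and the second lowers the degree.\<close>
  have "(\<lambda>t. \<Prod>g\<leftarrow>g # gs. g - t) = (\<lambda>t. (?n - t) * ?p t + (g - ?n) * ?p t)"
    by (simp add: fun_eq_iff algebra_simps)
  then have "f0_eval x (\<lambda>t. \<Prod>g\<leftarrow>g # gs. g - t) = f0_eval u ?p + (g - ?n) * f0_eval x ?p"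
    using f0_eval_Cons[of c u ?p] by (simp only: f0_eval_add f0_eval_mult x)
  then show ?case using Cons.IH[of u] Cons.IH[of x] Cons.prems x by simp
qed

section \<open>The product over the twos\<close>

definition g_prod :: "rat \<Rightarrow> yf_word \<Rightarrow> rat" where
  "g_prod t y = (\<Prod>j=1..num_twos y. rat_of_nat (yf_g y j) - t)"

lemma sum_list_one_runs: "sum_list (one_runs w) + 2 * num_twos w = digit_sum w"
proof (induction w rule: one_runs.induct)
  case (2 w)
  then show ?case using length_one_runs[of w] by (cases "one_runs w") auto
qed auto

lemma yf_beta_One: "i < num_twos w \<Longrightarrow> yf_beta (One # w) i = yf_beta w i"
  using length_one_runs[of w] by (cases "one_runs w") (auto simp: yf_beta_def nth_append)

lemma yf_beta_Two: "i \<le> num_twos w \<Longrightarrow> yf_beta (Two # w) i = yf_beta w i"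
  by (simp add: yf_beta_def nth_append length_one_runs)

lemma sum_yf_beta: "(\<Sum>i<Suc (num_twos w). yf_beta w i) + 2 * num_twos w = digit_sum w"
proof -
  have "(\<Sum>i<Suc (num_twos w). yf_beta w i) = sum_list (rev (one_runs w))"
    by (simp add: sum_list_sum_nth length_one_runs yf_beta_def atLeast0LessThan del: sum_list_rev)
  then show ?thesis using sum_list_one_runs[of w] by simp
qed

text \<open>\<open>yf_g y j\<close> is one more than the digit sum to the right of the
  \<open>j\<close>-th Two, counted from the right. So a leading One changes nothing and a leading
  Two adds the last factor.\<close>

lemma g_prod_simps [simp]:
  "g_prod t [] = 1"
  "g_prod t (One # w) = g_prod t w"
  "g_prod t (Two # w) = (of_nat (digit_sum w) + 1 - t) * g_prod t w"
proof -
  show "g_prod t (One # w) = g_prod t w"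
    unfolding g_prod_def yf_g_def by (intro prod.cong) (auto intro!: sum.cong simp: yf_beta_One)
  have "yf_g (Two # w) (Suc (num_twos w)) =
      (\<Sum>i<Suc (num_twos w). yf_beta (Two # w) i) + 2 * Suc (num_twos w) - 1"
    by (simp only: yf_g_def)
  also have "(\<Sum>i<Suc (num_twos w). yf_beta (Two # w) i) = (\<Sum>i<Suc (num_twos w). yf_beta w i)"
    by (intro sum.cong) (auto simp: yf_beta_Two)
  finally have top: "yf_g (Two # w) (Suc (num_twos w)) = Suc (digit_sum w)"
    using sum_yf_beta[of w] by simp
  have "(\<Prod>j=1..num_twos w. rat_of_nat (yf_g (Two # w) j) - t) = g_prod t w"
    unfolding g_prod_def yf_g_def by (intro prod.cong) (auto intro!: sum.cong simp: yf_beta_Two)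
  then show "g_prod t (Two # w) = (of_nat (digit_sum w) + 1 - t) * g_prod t w"
    by (simp add: g_prod_def[of t "Two # w"] top algebra_simps)
qed (simp add: g_prod_def)

text \<open>An appended letter raises these digit sums by its value, which amounts to a shift of
  \<open>t\<close>; an appended Two also adds the factor with \<open>g = 1\<close>.\<close>

lemma g_prod_snoc [simp]:
  "g_prod t (w @ [One]) = g_prod (t - 1) w"
  "g_prod t (w @ [Two]) = (1 - t) * g_prod (t - 2) w"
  by (induction w rule: one_runs.induct) simp_all

text \<open>The failure of \<open>g_prod t\<close> to be fixed by \<open>down_sum\<close>, which the
  remainder \<open>residue\<close> has to compensate.\<close>

definition defect :: "rat \<Rightarrow> yf_word \<Rightarrow> rat" where
  "defect t w = g_prod t w - down_sum (g_prod t) w"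

text \<open>On the lower covers of \<open>w\<close> the factor of the leading Two is
  \<open>|w| - t\<close>, and lowering this Two takes away the remaining copy of
  \<open>g_prod t w\<close>.\<close>

lemma defect_simps [simp]:
  "defect t [] = 1"
  "defect t (One # w) = 0"
  "defect t (Two # w) = (of_nat (digit_sum w) - t) * defect t w"
proof -
  have "down_sum (\<lambda>v. g_prod t (Two # v)) w =
      down_sum (\<lambda>v. (of_nat (digit_sum w) - t) * g_prod t v) w"
    by (rule down_sum_cong) simp
  then show "defect t (Two # w) = (of_nat (digit_sum w) - t) * defect t w"
    by (simp add: defect_def down_sum_mult del: g_prod_simps(3)) (simp add: algebra_simps)
qed (simp_all add: defect_def)

lemma defect_eq_0: "One \<in> set w \<Longrightarrow> defect t w = 0"
  by (induction w rule: one_runs.induct) auto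

lemma defect_0: "w \<noteq> [] \<Longrightarrow> defect 0 w = 0"
proof (induction w rule: one_runs.induct)
  case (3 w)
  then show ?case by (cases "w = []") auto
qed auto

lemma defect_snoc_Two: "defect t (w @ [Two]) = - t * defect (t - 2) w"
  by (induction w rule: one_runs.induct) (auto simp: algebra_simps)

lemma defect_twos: "One \<notin> set w \<Longrightarrow> defect t (w @ [Two]) = - t * g_prod (t - 1) w"
  by (induction w rule: one_runs.induct) (auto simp: algebra_simps)

section \<open>Common suffixes\<close>

lemma common_suffix_length_eq:
  "common_suffix_length x y = Max (length ` {s. suffix s x \<and> suffix s y})"
  by (simp add: common_suffix_length_def setcompr_eq_image)

lemma common_suffix_length_Nil [simp]:
  "common_suffix_length [] y = 0" "common_suffix_length x [] = 0"
  by (simp_all add: common_suffix_length_eq conj_commute)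

lemma common_suffix_length_neq:
  assumes "c \<noteq> d"
  shows "common_suffix_length (x @ [c]) (y @ [d]) = 0"
proof -
  have "{s. suffix s (x @ [c]) \<and> suffix s (y @ [d])} = {[]}"
    using assms by auto
  then show ?thesis by (simp only: common_suffix_length_eq) simp
qed

lemma common_suffix_length_snoc [simp]:
  "common_suffix_length (x @ [c]) (y @ [c]) = Suc (common_suffix_length x y)"
proof -
  let ?L = "{s. suffix s x \<and> suffix s y}"
  have "{s. suffix s (x @ [c]) \<and> suffix s (y @ [c])} = insert [] ((\<lambda>s. s @ [c]) ` ?L)"
    by auto
  then have L: "length ` {s. suffix s (x @ [c]) \<and> suffix s (y @ [c])} = insert 0 (Suc ` length ` ?L)"
    by (simp only: image_insert image_image length_append) simp
  have fin: "finite (length ` ?L)"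
    by (rule finite_subset[of _ "{..length x}"]) (auto dest: suffix_length_le)
  have ne: "length ` ?L \<noteq> {}" using Nil_suffix by blast
  show ?thesis
    using mono_Max_commute[OF mono_Suc fin ne] fin ne unfolding common_suffix_length_eq L by simp
qed

text \<open>The only new suffix is \<open>c # y\<close> itself, whose digit sum is too large for a
  suffix of \<open>x\<close>.\<close>

lemma common_suffix_length_Cons:
  assumes "digit_sum x \<le> digit_sum y"
  shows "common_suffix_length x (c # y) = common_suffix_length x y"
proof -
  have "\<not> suffix (c # y) x"
  proof
    assume "suffix (c # y) x"
    then have "digit_sum (c # y) \<le> digit_sum x" by (auto simp: suffix_def)
    with assms show False using digit_val_pos[of c] by simp
  qed
  then have "suffix s x \<and> suffix s (c # y) \<longleftrightarrow> suffix s x \<and> suffix s y" for s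
    by (auto simp: suffix_Cons)
  then show ?thesis by (simp add: common_suffix_length_eq)
qed

lemma yf_F_eq: "yf_F x y i = yf_f x i (common_suffix_length x y) * g_prod (of_nat i) y"
  by (simp add: yf_F_def g_prod_def)

lemma yf_F_Two:
  "digit_sum x \<le> digit_sum y \<Longrightarrow>
    yf_F x (Two # y) i = (of_nat (digit_sum y) + 1 - of_nat i) * yf_F x y i"
  by (simp add: yf_F_eq common_suffix_length_Cons)

section \<open>The contribution of the common suffix\<close>

definition residue :: "yf_word \<Rightarrow> yf_word \<Rightarrow> nat \<Rightarrow> rat" where
  "residue x y i = yf_F x y i - yf_f0 x i * g_prod (of_nat i) y"

lemma residue_Nil [simp]: "residue [] y i = 0" "residue x [] i = 0"
  by (simp_all add: residue_def yf_F_eq)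

lemma residue_neq: "c \<noteq> d \<Longrightarrow> residue (x @ [c]) (y @ [d]) i = 0"
  by (simp add: residue_def yf_F_eq common_suffix_length_neq)

lemma residue_snoc_One:
  "residue (x @ [One]) (y @ [One]) i = (if i = 0 then 0 else yf_F x y (i - 1))"
  by (simp add: residue_def yf_F_eq algebra_simps)

text \<open>The node 1, present only for the ending \<open>11\<close>, contributes the factor
  \<open>1 / (1 - 0)\<close>.\<close>

lemma yf_f0_snoc_One_One_0: "yf_f0 (x @ [One, One]) 0 = yf_f0 (x @ [Two]) 0"
proof -
  have "suffix_sums (x @ [One, One]) - {0} = insert 1 ((+) 2 ` suffix_sums x)"
    using suffix_sums_snoc[of "x @ [One]" One]
    by (auto simp: suffix_sums_snoc image_iff)
  moreover have "suffix_sums (x @ [Two]) - {0} = (+) 2 ` suffix_sums x"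
    by (auto simp: suffix_sums_snoc)
  moreover have "0 \<in> suffix_sums (x @ [One, One])" "0 \<in> suffix_sums (x @ [Two])"
    using suffix_sums_snoc[of "x @ [One]" One] by (simp_all add: suffix_sums_snoc)
  moreover have "1 \<notin> (+) 2 ` suffix_sums x" by auto
  ultimately show ?thesis by (simp add: yf_f0_eq_prod)
qed

text \<open>By \<open>yf_f0_snoc\<close> the three terms, signs included, are
  \<open>yf_f0 x (i - 2)\<close> times \<open>1/(i(i-1))\<close>, \<open>-1/(i-1)\<close> and
  \<open>(1-i)/i\<close>, which add up to \<open>-1\<close>.\<close>

lemma yf_f0_expand_Two:
  assumes "2 \<le> i"
  shows "yf_f0 (x @ [One, One]) i + yf_f0 (x @ [One]) (i - 1) - (1 - of_nat i) * yf_f0 (x @ [Two]) i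
    = - yf_f0 x (i - 2)"
proof -
  define r where "r = rat_of_nat i"
  obtain j where i: "i = Suc (Suc j)" using assms by (metis add_2_eq_Suc le_Suc_ex)
  have r: "r \<noteq> 0" "r - 1 \<noteq> 0" by (auto simp: r_def i)
  have "r * yf_f0 (x @ [One, One]) i = - yf_f0 (x @ [One]) (i - 1)"
    using yf_f0_snoc[of i "x @ [One]" One] by (simp add: r_def i)
  then have 1: "yf_f0 (x @ [One, One]) i = - yf_f0 (x @ [One]) (i - 1) / r"
    using r by (simp add: field_simps)
  have "(r - 1) * yf_f0 (x @ [One]) (i - 1) = - yf_f0 x (i - 2)"
    using yf_f0_snoc[of "i - 1" x One] by (simp add: r_def i)
  then have 2: "yf_f0 (x @ [One]) (i - 1) = - yf_f0 x (i - 2) / (r - 1)"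
    using r by (simp add: field_simps)
  have "r * yf_f0 (x @ [Two]) i = - yf_f0 x (i - 2)"
    using yf_f0_snoc[of i x Two] by (simp add: r_def i)
  then have 3: "yf_f0 (x @ [Two]) i = - yf_f0 x (i - 2) / r"
    using r by (simp add: field_simps)
  show ?thesis
    unfolding 1 2 3 r_def[symmetric] using r by (simp add: divide_simps) (simp add: algebra_simps)
qed

text \<open>The division by \<open>1 - i\<close> in the recursion of \<open>f\<close> cancels the
  factor that the last Two gives to \<open>g_prod\<close>. By \<open>yf_f0_expand_Two\<close> only
  the remainder for the shorter words is left, whereas a common last One leaves all of
  \<open>yf_F\<close>.\<close>

lemma residue_snoc_Two:
  "residue (x @ [Two]) (y @ [Two]) i = (if i < 2 then 0 else residue x y (i - 2))"
proof -
  define z where "z = common_suffix_length x y"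
  have f11: "yf_f (x @ [One, One]) i (Suc (Suc z)) =
      (if i = 0 then yf_f0 (x @ [One, One]) 0
       else yf_f0 (x @ [One, One]) i + yf_f (x @ [One]) (i - 1) (Suc z))" for i
    using yf_f.simps(3)[of "x @ [One]" i "Suc z"] by simp
  consider "i = 0" | "i = 1" | "2 \<le> i" by linarith
  then show ?thesis
  proof cases
    case 1
    then show ?thesis
      by (simp add: residue_def yf_F_eq z_def[symmetric] f11 yf_f0_snoc_One_One_0)
  next
    \<comment> \<open>The prescribed value \<open>f(x2,1,z) = 0\<close> fits, as the factor
      \<open>1 - i\<close> makes the split-off term vanish too.\<close>
    case 2
    then show ?thesis by (simp add: residue_def yf_F_eq)
  next
    case 3
    define r where "r = rat_of_nat i"
    have r: "1 - r \<noteq> 0" and ri: "rat_of_nat (i - 2) = r - 2"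
      using 3 by (auto simp: r_def of_nat_diff)
    have "yf_f (x @ [Two]) i (Suc z) = (yf_f0 (x @ [One, One]) i + yf_f0 (x @ [One]) (i - 1)
        + yf_f x (i - 2) z) / (1 - r)"
      using 3 by (simp add: f11 r_def numeral_2_eq_2)
    also have "\<dots> = (yf_f x (i - 2) z - yf_f0 x (i - 2)) / (1 - r) + yf_f0 (x @ [Two]) i"
      using yf_f0_expand_Two[OF 3, of x, folded r_def] r by (simp add: field_simps)
    finally have f2: "yf_f (x @ [Two]) i (Suc z) = \<dots>" .
    have "yf_F (x @ [Two]) (y @ [Two]) i =
        ((yf_f x (i - 2) z - yf_f0 x (i - 2)) / (1 - r) + yf_f0 (x @ [Two]) i)
          * ((1 - r) * g_prod (r - 2) y)"
      unfolding yf_F_eq common_suffix_length_snoc z_def[symmetric] f2 g_prod_snoc r_def ..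
    also have "\<dots> = (yf_f x (i - 2) z - yf_f0 x (i - 2)) * g_prod (r - 2) y
        + yf_f0 (x @ [Two]) i * ((1 - r) * g_prod (r - 2) y)"
      unfolding distrib_right using r by simp
    finally show ?thesis
      using 3 unfolding residue_def yf_F_eq[of x] ri z_def[symmetric] g_prod_snoc r_def[symmetric]
      by (simp add: left_diff_distrib)
  qed
qed

text \<open>The recursion strips common final twos until a word is empty or the last letters
  differ.\<close>

lemma residue_twos: "One \<notin> set w \<Longrightarrow> residue x w i = 0"
proof (induction w arbitrary: x i rule: rev_induct)
  case (snoc d w)
  then show ?case
    by (cases x rule: rev_cases; cases d; cases "last x")
      (auto simp: residue_snoc_Two residue_neq)
qed simp

section \<open>The operators applied to \<open>yf_F\<close>\<close>

lemma down_sum_yf_F_eq: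
  "down_sum (\<lambda>v. yf_F x v i) w - yf_F x w i =
    down_sum (\<lambda>v. residue x v i) w - residue x w i - yf_f0 x i * defect (of_nat i) w"
proof -
  have F: "yf_F x v i = yf_f0 x i * g_prod (of_nat i) v + residue x v i" for v
    by (simp add: residue_def)
  show ?thesis
    unfolding F down_sum_linear defect_def by (simp add: right_diff_distrib)
qed

text \<open>By \<open>down_sum_yf_F_eq\<close> the change of the remainder under
  \<open>down_sum\<close> must equal \<open>yf_f0 x i\<close> times the defect of \<open>w\<close>.
  For nonempty \<open>x\<close> this is checked on the four pairs of last letters.\<close>

lemma down_sum_yf_F:
  "digit_sum x < digit_sum w \<Longrightarrow> down_sum (\<lambda>v. yf_F x v i) w = yf_F x w i"
proof (induction x arbitrary: w i rule: rev_induct)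
  case Nil
  then have "w \<noteq> []" by auto
  \<comment> \<open>For empty \<open>x\<close> the weight lives at \<open>i = 0\<close>, where the
    defect of a nonempty word vanishes.\<close>
  then show ?case
    using down_sum_yf_F_eq[of "[]" i w] defect_0[of w] by (cases "i = 0") (simp_all add: yf_f0_Nil)
next
  case (snoc c x)
  then obtain u d where w: "w = u @ [d]" by (cases w rule: rev_cases) auto
  have "down_sum (\<lambda>v. residue (x @ [c]) v i) w - residue (x @ [c]) w i
      = yf_f0 (x @ [c]) i * defect (of_nat i) w"
  proof (cases d)
    case One
    have "defect (of_nat i) w = 0" by (simp add: w One defect_eq_0)
    moreover have "down_sum (\<lambda>v. residue (x @ [c]) v i) w = residue (x @ [c]) w i"
    proof (cases c)
      case One
      with \<open>d = One\<close> snoc show ?thesis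
        by (simp add: w down_sum_snoc_One residue_snoc_One residue_twos)
    next
      case Two
      with \<open>d = One\<close> show ?thesis
        by (simp add: w down_sum_snoc_One residue_neq residue_twos)
    qed
    ultimately show ?thesis by simp
  next
    case Two
    show ?thesis
    proof (cases c)
      case One
      \<comment> \<open>Every lower cover of \<open>w\<close> ends in Two except
        \<open>u @ [One]\<close>, which occurs only if \<open>u\<close> has no One; it alone shares
        its last letter with \<open>x @ [c]\<close>.\<close>
      have "down_sum (\<lambda>v. residue (x @ [c]) v i) w - residue (x @ [c]) w i =
          (if One \<in> set u \<or> i = 0 then 0 else yf_F x u (i - 1))"
        using One \<open>d = Two\<close> by (simp add: w down_sum_snoc_Two residue_snoc_One residue_neq)
      also have "\<dots> = (if One \<in> set u \<or> i = 0 then 0 else yf_f0 x (i - 1) * g_prod (of_nat (i - 1)) u)"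
        using residue_twos[of u x "i - 1"] by (auto simp: residue_def)
      also have "\<dots> = yf_f0 (x @ [c]) i * defect (of_nat i) w"
      proof (cases "One \<in> set u \<or> i = 0")
        case True
        then show ?thesis by (auto simp: w defect_eq_0 defect_0)
      next
        case False
        then have "yf_f0 x (i - 1) = - (of_nat i * yf_f0 (x @ [One]) i)"
          by (simp add: yf_f0_snoc)
        with False show ?thesis
          using One \<open>d = Two\<close> by (simp add: w defect_twos of_nat_diff)
      qed
      finally show ?thesis .
    next
      case Two
      have "down_sum (\<lambda>v. residue (x @ [c]) v i) w - residue (x @ [c]) w i =
          (if i < 2 then 0 else down_sum (\<lambda>v. residue x v (i - 2)) u - residue x u (i - 2))"
        using Two \<open>d = Two\<close> by (simp add: w down_sum_snoc_Two residue_snoc_Two residue_neq)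
      \<comment> \<open>The induction hypothesis for \<open>x\<close> and \<open>u\<close>, read
        backwards through \<open>down_sum_yf_F_eq\<close>.\<close>
      also have "\<dots> = (if i < 2 then 0 else yf_f0 x (i - 2) * defect (of_nat (i - 2)) u)"
        using down_sum_yf_F_eq[of x "i - 2" u] snoc.IH[of u "i - 2"] snoc.prems Two \<open>d = Two\<close>
        by (simp add: w)
      also have "\<dots> = - (of_nat i * yf_f0 (x @ [c]) i) * defect (of_nat i - 2) u"
        using Two by (auto simp: yf_f0_snoc of_nat_diff)
      also have "\<dots> = yf_f0 (x @ [c]) i * defect (of_nat i) w"
        using \<open>d = Two\<close> by (simp add: w defect_snoc_Two)
      finally show ?thesis .
    qed
  qed
  then show ?case using down_sum_yf_F_eq[of "x @ [c]" i w] by simp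
qed

lemma up_sum_yf_F:
  assumes "digit_sum x \<le> digit_sum y"
  shows "up_sum (\<lambda>v. yf_F x v i) y = (of_nat (digit_sum y) + 1 - of_nat i) * yf_F x y i"
  using down_sum_yf_F[of x "Two # y" i] assms
  by (simp add: up_sum_eq_down_sum yf_F_Two del: down_sum_simps)

section \<open>The sum of \<open>yf_F\<close> at equal ranks\<close>

lemma digit_sum_length: "digit_sum w + count_list w One = 2 * length w"
  by (induction w rule: one_runs.induct) auto

lemma digit_sum_num_twos: "digit_sum w = 2 * num_twos w + count_list w One"
  by (induction w rule: one_runs.induct) auto

lemma replicate_Two: "One \<notin> set w \<Longrightarrow> w = replicate (length w) Two"
  by (induction w rule: one_runs.induct) auto

text \<open>The degree \<open>num_twos y\<close> of the product is at most half the common digit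
  sum, which is at most \<open>length x\<close>; equality throughout forces both words to consist of
  twos.\<close>

lemma f0_eval_g_prod:
  assumes "digit_sum x = digit_sum y"
  shows "f0_eval x (\<lambda>t. g_prod t y) = (if x = y \<and> One \<notin> set x then 1 else 0)"
proof -
  define gs where "gs = map (\<lambda>j. rat_of_nat (yf_g y j)) [1..<Suc (num_twos y)]"
  have "set [1..<Suc (num_twos y)] = {1..num_twos y}" by auto
  then have "g_prod t y = (\<Prod>g\<leftarrow>gs. g - t)" for t
    using prod.distinct_set_conv_list[of "[1..<Suc (num_twos y)]" "\<lambda>j. rat_of_nat (yf_g y j) - t"]
    by (simp add: g_prod_def gs_def comp_def del: upt_Suc)
  moreover have len: "length gs = num_twos y" by (simp add: gs_def)
  ultimately have "f0_eval x (\<lambda>t. g_prod t y) = (if num_twos y = length x then 1 else 0)"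
    using f0_eval_prod_list[of gs x] digit_sum_length[of x] digit_sum_num_twos[of y] assms by simp
  moreover have "num_twos y = length x \<longleftrightarrow> x = y \<and> One \<notin> set x"
  proof
    assume *: "num_twos y = length x"
    then have "count_list x One = 0" "count_list y One = 0"
      using digit_sum_length[of x] digit_sum_num_twos[of y] assms by linarith+
    moreover from this have "length x = length y"
      using digit_sum_length[of x] digit_sum_length[of y] assms by simp
    ultimately show "x = y \<and> One \<notin> set x"
      using replicate_Two[of x] replicate_Two[of y] by (auto simp: count_list_0_iff)
  next
    assume "x = y \<and> One \<notin> set x"
    then show "num_twos y = length x"
      using digit_sum_length[of x] digit_sum_num_twos[of x] count_list_0_iff[of x One] by auto
  qed
  ultimately show ?thesis by simp
qed

text \<open>With different last letters only the divided difference remains, and it is zero. A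
  common last One makes it zero as well and turns the remainder into the sum for the shorter
  words.\<close>

lemma sum_yf_F_same_rank:
  "digit_sum x = digit_sum y \<Longrightarrow> (\<Sum>i\<le>digit_sum x. yf_F x y i) = (if x = y then 1 else 0)"
proof (induction x arbitrary: y rule: rev_induct)
  case Nil
  then show ?case by (cases y) (simp_all add: yf_F_eq yf_f0_Nil)
next
  case (snoc c x)
  have F: "(\<Sum>i\<le>digit_sum x. yf_F x y i) = f0_eval x (\<lambda>t. g_prod t y) + (\<Sum>i\<le>digit_sum x. residue x y i)"
    for x y
    by (simp add: f0_eval_def residue_def sum_subtractf)
  obtain u d where y: "y = u @ [d]" using snoc.prems by (cases y rule: rev_cases) auto
  show ?case
  proof (cases "c = d")
    case False
    then show ?thesis
      unfolding F using f0_eval_g_prod[OF snoc.prems] by (simp add: y residue_neq)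
  next
    case True
    then have eq: "digit_sum x = digit_sum u" using snoc.prems by (simp add: y)
    show ?thesis
    proof (cases c)
      case One
      then have "(\<Sum>i\<le>digit_sum (x @ [c]). residue (x @ [c]) y i) =
          (\<Sum>i\<le>Suc (digit_sum x). if i = 0 then 0 else yf_F x u (i - 1))"
        using True by (simp add: y residue_snoc_One)
      also have "\<dots> = (\<Sum>i\<le>digit_sum x. yf_F x u i)"
        by (simp only: sum.atMost_Suc_shift) simp
      finally show ?thesis
        unfolding F[of "x @ [c]"] using snoc.IH[OF eq] f0_eval_g_prod[OF snoc.prems] One True by (simp add: y)
    next
      case Two
      then have "(\<Sum>i\<le>digit_sum (x @ [c]). residue (x @ [c]) y i) =
          (\<Sum>i\<le>Suc (Suc (digit_sum x)). if i < 2 then 0 else residue x u (i - 2))"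
        using True by (simp add: y residue_snoc_Two)
      also have "\<dots> = (\<Sum>i\<le>digit_sum x. residue x u i)"
        by (simp only: sum.atMost_Suc_shift) simp
      finally have "(\<Sum>i\<le>digit_sum (x @ [c]). residue (x @ [c]) y i) =
          (\<Sum>i\<le>digit_sum x. residue x u i)" .
      \<comment> \<open>The condition in \<open>f0_eval_g_prod\<close> is the same for
        \<open>x\<close>, \<open>u\<close> as after appending Two, so the divided differences agree
        and the whole sum passes to the shorter words.\<close>
      then show ?thesis
        unfolding F[of "x @ [c]"]
        using snoc.IH[OF eq, unfolded F] f0_eval_g_prod[OF snoc.prems] f0_eval_g_prod[OF eq] Two True
        by (simp add: y split: if_splits)
    qed
  qed
qed

section \<open>Counting paths\<close>

lemma is_S_path_singleton: "is_S_path S y x [a] \<longleftrightarrow> a = y \<and> a = x \<and> S = 0"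
  by (auto simp: is_S_path_def)

lemma is_S_path_Cons:
  "is_S_path S y x (a # b # ps) \<longleftrightarrow> a = y \<and>
     (yf_up b a \<and> is_S_path S b x (b # ps) \<or>
      yf_up a b \<and> S \<noteq> 0 \<and> is_S_path (S - 1) b x (b # ps))"
proof -
  define up where "up qs = {i \<in> {1..<length qs}.
    int (digit_sum (qs ! i)) - int (digit_sum (qs ! (i - 1))) = 1}" for qs :: "yf_word list"
  have fin: "finite (up qs)" for qs by (simp add: up_def)
  have I: "{1..<length (a # b # ps)} = insert 1 (Suc ` {1..<length (b # ps)})"
    by (auto simp: image_iff)
  have adj: "(\<forall>i\<in>{1..<length (a # b # ps)}. yf_adj ((a # b # ps) ! (i - 1)) ((a # b # ps) ! i)) \<longleftrightarrow>
      yf_adj a b \<and> (\<forall>i\<in>{1..<length (b # ps)}. yf_adj ((b # ps) ! (i - 1)) ((b # ps) ! i))"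
    unfolding I by (auto simp: nth_Cons' simp del: image_Suc_atLeastLessThan)
  have "up (a # b # ps) = (if digit_sum b = Suc (digit_sum a) then {1} else {}) \<union> Suc ` up (b # ps)"
    unfolding up_def I by (auto simp: nth_Cons' simp del: image_Suc_atLeastLessThan)
  moreover have "card (Suc ` up (b # ps)) = card (up (b # ps))" by (simp add: card_image)
  moreover have "1 \<notin> Suc ` up (b # ps)" by (auto simp: up_def)
  ultimately have card: "card (up (a # b # ps)) =
      (if digit_sum b = Suc (digit_sum a) then 1 else 0) + card (up (b # ps))"
    using fin by simp
  have path: "is_S_path T v x qs \<longleftrightarrow> qs \<noteq> [] \<and> hd qs = v \<and> last qs = x \<and>
     (\<forall>i\<in>{1..<length qs}. yf_adj (qs ! (i - 1)) (qs ! i)) \<and> card (up qs) = T" for T v qs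
    by (simp only: is_S_path_def up_def)
  \<comment> \<open>The two directions of an edge exclude each other by rank, so the first step is
    counted exactly if \<open>yf_up a b\<close>.\<close>
  consider "yf_up a b" "\<not> yf_up b a" "digit_sum b = Suc (digit_sum a)"
    | "yf_up b a" "\<not> yf_up a b" "digit_sum b \<noteq> Suc (digit_sum a)"
    | "\<not> yf_up a b" "\<not> yf_up b a"
    using digit_sum_yf_up[of a b] digit_sum_yf_up[of b a] by linarith
  then show ?thesis
    unfolding path adj card by cases (auto simp: yf_adj_def)
qed

lemma is_S_path_length:
  "is_S_path S y x ps \<Longrightarrow> digit_sum y + 2 * S + 1 = digit_sum x + length ps"
proof (induction ps arbitrary: S y rule: induct_list012)
  case (3 a b ps)
  then show ?case
    using digit_sum_yf_up[of a b] digit_sum_yf_up[of b a] by (fastforce simp: is_S_path_Cons)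
qed (auto simp: is_S_path_singleton is_S_path_def)

text \<open>Splitting by the first step gives the recursion of \<open>words\<close>. Finiteness is
  carried along because cardinalities of disjoint unions are added.\<close>

lemma num_S_paths_of_length:
  "finite {ps. is_S_path S y x ps \<and> length ps = Suc n} \<and>
   rat_of_nat (card {ps. is_S_path S y x ps \<and> length ps = Suc n}) =
     yf.words n S (\<lambda>v. if v = x then 1 else 0) y"
proof (induction n arbitrary: S y)
  case 0
  have "{ps. is_S_path S y x ps \<and> length ps = Suc 0} = (if S = 0 \<and> y = x then {[y]} else {})"
    by (auto simp: length_Suc_conv is_S_path_singleton)
  then show ?case by simp
next
  case (Suc n)
  define Q where "Q S v = {ps. is_S_path S v x ps \<and> length ps = Suc n}" for S v
  have fin: "finite (Q S v)" and
    card: "rat_of_nat (card (Q S v)) = yf.words n S (\<lambda>v. if v = x then 1 else 0) v" for S v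
    using Suc.IH by (simp_all add: Q_def)
  have disj: "Q S v \<inter> Q T u = {}" if "v \<noteq> u" for S T u v
    using that by (auto simp: Q_def is_S_path_def)
  let ?A = "\<Union>v\<in>{v. yf_up v y}. Q S v"
  let ?B = "if S = 0 then {} else \<Union>u\<in>{u. yf_up y u}. Q (S - 1) u"
  have eq: "{ps. is_S_path S y x ps \<and> length ps = Suc (Suc n)} = (#) y ` (?A \<union> ?B)"
  proof (rule set_eqI)
    fix ps
    show "ps \<in> {ps. is_S_path S y x ps \<and> length ps = Suc (Suc n)} \<longleftrightarrow> ps \<in> (#) y ` (?A \<union> ?B)"
    proof (cases "\<exists>a b qs. ps = a # b # qs")
      case True
      then obtain a b qs where ps: "ps = a # b # qs" by blast
      have "b # qs \<in> Q T v \<longleftrightarrow> v = b \<and> is_S_path T b x (b # qs) \<and> length qs = n" for T v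
        by (auto simp: Q_def is_S_path_def)
      then show ?thesis by (auto simp: ps is_S_path_Cons image_iff)
    next
      case False
      then have "length ps \<noteq> Suc (Suc n)" by (auto simp: length_Suc_conv)
      then show ?thesis by (auto simp: Q_def split: if_splits)
    qed
  qed
  have finA: "finite ?A" and finB: "finite ?B" using fin by auto
  have "Q S v \<inter> Q (S - 1) u = {}" if "yf_up v y" "yf_up y u" for u v
    using digit_sum_yf_up[OF that(1)] digit_sum_yf_up[OF that(2)] by (intro disj) auto
  then have "?A \<inter> ?B = {}" by (cases "S = 0") (simp, simp, blast)
  then have "card {ps. is_S_path S y x ps \<and> length ps = Suc (Suc n)} = card ?A + card ?B"
    unfolding eq by (subst card_image) (simp_all add: card_Un_disjoint finA finB del: UN_simps)
  moreover have "card ?A = (\<Sum>v | yf_up v y. card (Q S v))"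
    using fin disj by (intro card_UN_disjoint) auto
  moreover have "card (\<Union>u\<in>{u. yf_up y u}. Q (S - 1) u) = (\<Sum>u | yf_up y u. card (Q (S - 1) u))"
    using fin disj by (intro card_UN_disjoint) auto
  moreover note down_sum_def[of "yf.words n S (\<lambda>v. if v = x then 1 else 0)" y]
    up_sum_def[of "yf.words n (S - 1) (\<lambda>v. if v = x then 1 else 0)" y]
  ultimately show ?case
    using finA finB by (auto simp: eq card)
qed

lemma num_S_paths_eq_words:
  assumes "digit_sum y + 2 * S = digit_sum x + n"
  shows "rat_of_nat (num_S_paths x y S) = yf.words n S (\<lambda>v. if v = x then 1 else 0) y"
proof -
  have "{ps. is_S_path S y x ps} = {ps. is_S_path S y x ps \<and> length ps = Suc n}"
    using is_S_path_length[of S y x] assms by fastforce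
  then show ?thesis using num_S_paths_of_length[of S y x n] by (simp add: num_S_paths_def)
qed

section \<open>Reduction to one variable\<close>

lemma down_power_delta:
  "digit_sum y = digit_sum x + j \<Longrightarrow>
    (down_sum ^^ j) (\<lambda>v. if v = x then 1 else 0) y = (\<Sum>i\<le>digit_sum x. yf_F x y i)"
proof (induction j arbitrary: y)
  case 0
  then show ?case using sum_yf_F_same_rank[of x y] by auto
next
  case (Suc j)
  have "(down_sum ^^ Suc j) (\<lambda>v. if v = x then 1 else 0) y =
      down_sum (\<lambda>v. \<Sum>i\<le>digit_sum x. 1 * yf_F x v i) y"
    unfolding funpow.simps comp_def using Suc by (intro down_sum_cong) simp
  also have "\<dots> = (\<Sum>i\<le>digit_sum x. 1 * down_sum (\<lambda>v. yf_F x v i) y)"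
    by (subst yf.D_sum) simp_all
  also have "\<dots> = (\<Sum>i\<le>digit_sum x. yf_F x y i)"
    using Suc.prems by (intro sum.cong) (simp_all add: down_sum_yf_F)
  finally show ?case .
qed

text \<open>With \<open>b = |y| - i\<close> the steps up multiply by
  \<open>(b + 1) ... (b + s)\<close>. All ranks on the way are at least \<open>|x|\<close>, where
  \<open>up_sum_yf_F\<close> applies.\<close>

lemma up_power_down_power_delta:
  "digit_sum y + s = digit_sum x + j \<Longrightarrow> digit_sum x \<le> digit_sum y \<Longrightarrow>
    (up_sum ^^ s) ((down_sum ^^ j) (\<lambda>v. if v = x then 1 else 0)) y =
    (\<Sum>i\<le>digit_sum x. fact (digit_sum y - i + s) / fact (digit_sum y - i) * yf_F x y i)"
proof (induction s arbitrary: y)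
  case 0
  then show ?case by (simp add: down_power_delta)
next
  case (Suc s)
  let ?c = "\<lambda>b. fact (b + s) / fact b :: rat"
  have "(up_sum ^^ Suc s) ((down_sum ^^ j) (\<lambda>v. if v = x then 1 else 0)) y =
      up_sum (\<lambda>v. \<Sum>i\<le>digit_sum x. ?c (Suc (digit_sum y) - i) * yf_F x v i) y"
    unfolding funpow.simps comp_def using Suc by (intro up_sum_cong) simp
  also have "\<dots> = (\<Sum>i\<le>digit_sum x. ?c (Suc (digit_sum y) - i) * up_sum (\<lambda>v. yf_F x v i) y)"
    by (subst yf.U_sum) simp_all
  also have "\<dots> = (\<Sum>i\<le>digit_sum x.
      fact (digit_sum y - i + Suc s) / fact (digit_sum y - i) * yf_F x y i)"
  proof (intro sum.cong refl)
    fix i assume "i \<in> {..digit_sum x}"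
    then obtain b where b: "digit_sum y = b + i"
      using Suc.prems by (metis atMost_iff le_Suc_ex add.commute order_trans)
    have "?c (Suc b) * rat_of_nat (Suc b) = fact (b + Suc s) / fact b"
      by (simp only: fact_Suc[of b]) (simp del: fact_Suc of_nat_Suc)
    moreover have "up_sum (\<lambda>v. yf_F x v i) y = rat_of_nat (Suc b) * yf_F x y i"
      using Suc.prems by (simp add: up_sum_yf_F) (simp add: b)
    ultimately show "?c (Suc (digit_sum y) - i) * up_sum (\<lambda>v. yf_F x v i) y =
        fact (digit_sum y - i + Suc s) / fact (digit_sum y - i) * yf_F x y i"
      by (simp add: b Suc_diff_le del: fact_Suc of_nat_Suc add_Suc_right flip: mult.assoc)
  qed
  finally show ?case .
qed

text \<open>After normal ordering both sides carry the same \<open>order_coeff\<close> and the same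
  quotients of factorials, so they agree term by term.\<close>

lemma yf_words_eq_poly_words:
  assumes "digit_sum x \<le> digit_sum y" and "digit_sum y + 2 * s = digit_sum x + n"
  shows "yf.words n s (\<lambda>v. if v = x then 1 else 0) y =
    (\<Sum>i\<le>digit_sum x. yf_F x y i *
      poly.words n s (\<lambda>c. if c = digit_sum x - i then 1 else 0) (digit_sum y - i))"
proof -
  have "yf.words n s (\<lambda>v. if v = x then 1 else 0) y =
      (\<Sum>k\<le>s. order_coeff n s k * (\<Sum>i\<le>digit_sum x.
        fact (digit_sum y - i + (s - k)) / fact (digit_sum y - i) * yf_F x y i))"
    unfolding yf.words_eq
  proof (intro sum.cong refl)
    fix k assume "k \<in> {..s}"
    then show "order_coeff n s k *
        (up_sum ^^ (s - k)) ((down_sum ^^ (n - s - k)) (\<lambda>v. if v = x then 1 else 0)) y =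
      order_coeff n s k * (\<Sum>i\<le>digit_sum x.
        fact (digit_sum y - i + (s - k)) / fact (digit_sum y - i) * yf_F x y i)"
      using assms
      by (cases "s + k \<le> n") (simp_all add: order_coeff_eq_0 up_power_down_power_delta)
  qed
  also have "\<dots> = (\<Sum>i\<le>digit_sum x. yf_F x y i * (\<Sum>k\<le>s. order_coeff n s k *
      (fact (digit_sum y - i + (s - k)) / fact (digit_sum y - i))))"
    unfolding sum_distrib_left by (subst sum.swap) (simp add: mult_ac)
  also have "\<dots> = (\<Sum>i\<le>digit_sum x. yf_F x y i *
      poly.words n s (\<lambda>c. if c = digit_sum x - i then 1 else 0) (digit_sum y - i))"
    using assms by (intro sum.cong refl) (subst poly_words_delta, auto)
  finally show ?thesis .
qed

section \<open>Closed form in the polynomial model\<close>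

text \<open>The number \<open>(2k - 1)!!\<close> of perfect matchings of \<open>2k\<close>
  points.\<close>

definition matching_count :: "nat \<Rightarrow> rat" where
  "matching_count k = fact (2 * k) / (2 ^ k * fact k)"

text \<open>The number of ways to choose \<open>m\<close> disjoint pairs among \<open>b + 2m\<close>
  points.\<close>

definition partial_matchings :: "nat \<Rightarrow> nat \<Rightarrow> rat" where
  "partial_matchings b m = fact (b + 2 * m) / (fact b * 2 ^ m * fact m)"

text \<open>The last point is unmatched, or it is paired with one of the \<open>b + 1\<close> points
  left free by \<open>m - 1\<close> pairs among the others. The two cases have shares
  \<open>b\<close> and \<open>2m\<close> of the total \<open>b + 2m\<close>.\<close>

lemma partial_matchings_rec:
  assumes "b \<noteq> 0 \<or> m \<noteq> 0"
  shows "partial_matchings b m = (if b = 0 then 0 else partial_matchings (b - 1) m) +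
    (if m = 0 then 0 else of_nat (Suc b) * partial_matchings (Suc b) (m - 1))"
proof -
  define N where "N = b + 2 * m - 1"
  define K :: rat where "K = fact N / (fact b * 2 ^ m * fact m)"
  have N: "b + 2 * m = Suc N" using assms by (auto simp: N_def)
  have L: "partial_matchings b m = of_nat (Suc N) * K"
    by (simp add: partial_matchings_def N K_def del: of_nat_Suc)
  have 1: "(if b = 0 then 0 else partial_matchings (b - 1) m) = of_nat b * K"
  proof (cases b)
    case (Suc c)
    then have "c + 2 * m = N" using N by simp
    then show ?thesis
      by (simp add: partial_matchings_def K_def Suc del: of_nat_Suc)
  qed simp
  have 2: "(if m = 0 then 0 else of_nat (Suc b) * partial_matchings (Suc b) (m - 1)) = of_nat (2 * m) * K"
  proof (cases m)
    case (Suc c)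
    then have "Suc b + 2 * c = N" using N by simp
    then have "of_nat (Suc b) * partial_matchings (Suc b) c = fact N / (fact b * 2 ^ c * fact c)"
      by (simp add: partial_matchings_def del: of_nat_Suc add_Suc)
    also have "\<dots> = of_nat (2 * m) * K"
      by (simp add: K_def Suc del: of_nat_Suc) (simp add: field_simps del: of_nat_Suc, simp)
    finally show ?thesis by (simp add: Suc)
  qed simp
  show ?thesis unfolding L 1 2 distrib_right[symmetric] of_nat_add[symmetric] N ..
qed

text \<open>Both sides obey the same recursion in \<open>b\<close> and \<open>s\<close>, since the
  weights in front of \<open>partial_matchings\<close> depend on \<open>a\<close> and
  \<open>k\<close> only.\<close>

lemma poly_words_eq_matchings:
  "b + 2 * s = a + n \<Longrightarrow> poly.words n s (\<lambda>c. if c = a then 1 else 0) b =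
    (\<Sum>k\<le>s. (-1) ^ k * of_nat (a choose (2 * k)) * matching_count k * partial_matchings b (s - k))"
proof (induction n arbitrary: b s)
  case 0
  show ?case
  proof (cases "s = 0")
    case True
    then show ?thesis using 0 by (simp add: matching_count_def partial_matchings_def)
  next
    case False
    \<comment> \<open>Here \<open>a = b + 2s\<close>, and the sum is a multiple of the alternating
      sum of the binomials \<open>s choose k\<close>.\<close>
    have "(\<Sum>k\<le>s. (-1) ^ k * of_nat (a choose (2 * k)) * matching_count k * partial_matchings b (s - k)) =
        (\<Sum>k\<le>s. fact a / (fact b * 2 ^ s * fact s) * ((-1) ^ k * rat_of_nat (s choose k)))"
    proof (intro sum.cong refl)
      fix k assume "k \<in> {..s}"
      then obtain m where s: "s = k + m" using le_Suc_ex by auto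
      have a: "a = b + 2 * m + 2 * k" using 0 s by simp
      have "rat_of_nat (a choose (2 * k)) = fact a / (fact (2 * k) * fact (b + 2 * m))"
        by (subst binomial_fact) (auto simp: a)
      moreover have "rat_of_nat (s choose k) = fact s / (fact k * fact m)"
        by (subst binomial_fact) (auto simp: s)
      ultimately show "(-1) ^ k * of_nat (a choose (2 * k)) * matching_count k * partial_matchings b (s - k)
          = fact a / (fact b * 2 ^ s * fact s) * ((-1) ^ k * rat_of_nat (s choose k))"
        by (simp add: matching_count_def partial_matchings_def s power_add mult_ac)
    qed
    also have "\<dots> = 0"
      using False by (simp only: sum_distrib_left[symmetric] choose_alternating_sum)
    finally show ?thesis using False by simp
  qed
next
  case (Suc n)
  let ?w = "\<lambda>k. (-1) ^ k * of_nat (a choose (2 * k)) * matching_count k"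
  have D: "poly_down (poly.words n s (\<lambda>c. if c = a then 1 else 0)) b =
      (\<Sum>k\<le>s. ?w k * (if b = 0 then 0 else partial_matchings (b - 1) (s - k)))"
    using Suc.IH[of "b - 1" s] Suc.prems
    unfolding poly_down_def[of "poly.words n s (\<lambda>c. if c = a then 1 else 0)" b] by (cases b) auto
  have U: "(if s = 0 then 0 else poly_up (poly.words n (s - 1) (\<lambda>c. if c = a then 1 else 0)) b) =
      (\<Sum>k\<le>s. ?w k * (if s - k = 0 then 0
        else of_nat (Suc b) * partial_matchings (Suc b) (s - k - 1)))"
  proof (cases s)
    case (Suc t)
    have "poly.words n t (\<lambda>c. if c = a then 1 else 0) (Suc b) =
        (\<Sum>k\<le>t. ?w k * partial_matchings (Suc b) (t - k))"
      using Suc.IH[of "Suc b" t] Suc.prems Suc by simp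
    then show ?thesis
      unfolding poly_up_def[of "poly.words n (s - 1) (\<lambda>c. if c = a then 1 else 0)" b]
      by (auto simp: Suc sum_distrib_left Suc_diff_le mult_ac intro!: sum.cong)
  qed simp
  have "poly.words (Suc n) s (\<lambda>c. if c = a then 1 else 0) b =
     (\<Sum>k\<le>s. ?w k * ((if b = 0 then 0 else partial_matchings (b - 1) (s - k)) +
        (if s - k = 0 then 0 else of_nat (Suc b) * partial_matchings (Suc b) (s - k - 1))))"
    by (simp only: poly.words.simps D U sum.distrib distrib_left)
  also have "\<dots> = (\<Sum>k\<le>s. ?w k * partial_matchings b (s - k))"
  proof (intro sum.cong refl)
    fix k assume k: "k \<in> {..s}"
    show "?w k * ((if b = 0 then 0 else partial_matchings (b - 1) (s - k)) +
        (if s - k = 0 then 0 else of_nat (Suc b) * partial_matchings (Suc b) (s - k - 1))) =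
      ?w k * partial_matchings b (s - k)"
    proof (cases "b = 0 \<and> s - k = 0")
      \<comment> \<open>The recursion fails for \<open>b = 0\<close> and \<open>k = s\<close>, where
        \<open>partial_matchings\<close> is 1; but then \<open>2k = a + n + 1\<close>, so the
        binomial vanishes.\<close>
      case True
      then have "a < 2 * k" using k Suc.prems by simp
      then show ?thesis by simp
    next
      case False
      then show ?thesis using partial_matchings_rec[of b "s - k"] by simp
    qed
  qed
  finally show ?case .
qed

lemma odd_dfact_eq: "rat_of_int (odd_dfact (2 * int k - 1)) = matching_count k"
proof (induction k)
  case 0
  then show ?case by (simp add: odd_dfact_def matching_count_def)
next
  case (Suc k)
  have eq: "{j \<in> {1..2 * int (Suc k) - 1}. odd j} = insert (2 * int k + 1) {j \<in> {1..2 * int k - 1}. odd j}"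
    by (auto elim!: oddE)
  have fin: "finite {j \<in> {1..2 * int k - 1}. odd j}"
    by (rule finite_subset[of _ "{1..2 * int k - 1}"]) auto
  have "odd_dfact (2 * int (Suc k) - 1) = (2 * int k + 1) * odd_dfact (2 * int k - 1)"
    unfolding odd_dfact_def eq by (subst prod.insert[OF fin]) simp_all
  then have "rat_of_int (odd_dfact (2 * int (Suc k) - 1)) = (2 * of_nat k + 1) * matching_count k"
    using Suc by simp
  also have "\<dots> = matching_count (Suc k)"
    by (simp add: matching_count_def divide_simps)
  finally show ?case .
qed

lemma partial_matchings_eq:
  "partial_matchings b m = of_nat ((b + 2 * m) choose b) * matching_count m"
  by (simp add: partial_matchings_def matching_count_def binomial_fact)

theorem mainTheorem2:
  fixes x y :: yf_word and S :: nat
  assumes "digit_sum y \<ge> digit_sum x"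
  shows "rat_of_nat (num_S_paths x y S) =
    (\<Sum>i=0..digit_sum x.
      (\<Sum>k=0..yf_m (digit_sum x - i) S.
        (-1) ^ k
        * rat_of_nat ((digit_sum x - i) choose (2 * k))
        * rat_of_int (odd_dfact (2 * int k - 1))
        * rat_of_nat ((digit_sum y - i + 2 * S - 2 * k) choose (digit_sum y - i))
        * rat_of_int (odd_dfact (2 * int S - 2 * int k - 1)))
      * yf_F x y i)"
proof -
  define n where "n = digit_sum y - digit_sum x + 2 * S"
  have n: "digit_sum y + 2 * S = digit_sum x + n" using assms by (simp add: n_def)
  have "rat_of_nat (num_S_paths x y S) = (\<Sum>i\<le>digit_sum x. yf_F x y i *
      poly.words n S (\<lambda>c. if c = digit_sum x - i then 1 else 0) (digit_sum y - i))"
    by (simp only: num_S_paths_eq_words[OF n] yf_words_eq_poly_words[OF assms n])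
  also have "\<dots> = (\<Sum>i=0..digit_sum x.
      (\<Sum>k=0..yf_m (digit_sum x - i) S.
        (-1) ^ k
        * rat_of_nat ((digit_sum x - i) choose (2 * k))
        * rat_of_int (odd_dfact (2 * int k - 1))
        * rat_of_nat ((digit_sum y - i + 2 * S - 2 * k) choose (digit_sum y - i))
        * rat_of_int (odd_dfact (2 * int S - 2 * int k - 1)))
      * yf_F x y i)"
    unfolding atMost_atLeast0
  proof (intro sum.cong refl)
    fix i assume "i \<in> {0..digit_sum x}"
    then have i: "i \<le> digit_sum x" by simp
    let ?a = "digit_sum x - i" and ?b = "digit_sum y - i"
    have "poly.words n S (\<lambda>c. if c = ?a then 1 else 0) ?b =
        (\<Sum>k\<le>S. (-1) ^ k * of_nat (?a choose (2 * k)) * matching_count k * partial_matchings ?b (S - k))"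
      using i n assms by (intro poly_words_eq_matchings) linarith
    also have "\<dots> = (\<Sum>k=0..yf_m ?a S.
        (-1) ^ k
        * rat_of_nat (?a choose (2 * k))
        * rat_of_int (odd_dfact (2 * int k - 1))
        * rat_of_nat ((?b + 2 * S - 2 * k) choose ?b)
        * rat_of_int (odd_dfact (2 * int S - 2 * int k - 1)))"
    \<comment> \<open>For \<open>2k > |x| - i\<close> the binomial vanishes, which gives the cut-off
      in \<open>yf_m\<close>.\<close>
    proof (rule sum.mono_neutral_cong_right)
      show "\<forall>k\<in>{..S} - {0..yf_m ?a S}.
        (-1) ^ k * of_nat (?a choose (2 * k)) * matching_count k * partial_matchings ?b (S - k) = 0"
        by (auto simp: yf_m_def)
    next
      fix k assume "k \<in> {0..yf_m ?a S}"
      then obtain m where S: "S = k + m" using le_Suc_ex by (auto simp: yf_m_def)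
      have "2 * int S - 2 * int k - 1 = 2 * int m - 1" "?b + 2 * S - 2 * k = ?b + 2 * m"
        by (simp_all add: S)
      then show "(-1) ^ k * of_nat (?a choose (2 * k)) * matching_count k * partial_matchings ?b (S - k) =
        (-1) ^ k
        * rat_of_nat (?a choose (2 * k))
        * rat_of_int (odd_dfact (2 * int k - 1))
        * rat_of_nat ((?b + 2 * S - 2 * k) choose ?b)
        * rat_of_int (odd_dfact (2 * int S - 2 * int k - 1))"
        by (simp only: odd_dfact_eq partial_matchings_eq) (simp add: S)
    qed (auto simp: yf_m_def)
    finally show "yf_F x y i * poly.words n S (\<lambda>c. if c = ?a then 1 else 0) ?b =
      (\<Sum>k=0..yf_m ?a S.
        (-1) ^ k
        * rat_of_nat (?a choose (2 * k))
        * rat_of_int (odd_dfact (2 * int k - 1))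
        * rat_of_nat ((?b + 2 * S - 2 * k) choose ?b)
        * rat_of_int (odd_dfact (2 * int S - 2 * int k - 1)))
      * yf_F x y i"
      by (simp only: mult.commute)
  qed
  finally show ?thesis .
qed

end
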